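(* The dimension of $\mathfrak g^{-1,1}$ is given in each case (types (B), (C), (D)) by $$\dim\mathfrak g^{-1,1}_B=f_0f_1+f_1f_2+\dots+f_{m-2}f_{m-1}+f_{m-1}(f_m-1)/2+f_{m-1}(f_m-1)/2+f_{m-1},$$ $$\dim\mathfrak g^{-1,1}_C=f_0f_1+\dots+f_{m-1}f_m+f_m(f_m+1)/2,$$ $$\dim\mathfrak g^{-1,1}_D=f_0f_1+f_1f_2+\dots+f_{m-2}f_{m-1}+f_{m-1}f_m/2+f_{m-1}f_m/2,$$ where $f_kf_{k+1}$ for all $0\le k\le m-2$ and $f_{m-1}(f_m-1)/2$ (respectively $f_{m-1}f_m/2$ in type (D)) are the dimensions of the naturally embedded Grassmannians of type (A), and $f_m(f_m+1)/2$ is the dimension of the naturally embedded Grassmannian of type (C).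
   Context: $V$ is a real vector space with a polarised Hodge structure of weight $n$, $V_{\mathbb C}=\bigoplus_{p+q=n}V^{p,q}$, with Hodge numbers $f_i:=h^{n-i,i}=\dim V^{n-i,i}$; the polarisation $Q$ is symmetric for $n$ even, antisymmetric for $n$ odd, and $\mathfrak g$ is the Lie algebra of infinitesimal isometries of $Q$ on $V_{\mathbb C}$. Type (B): $n=2m$, $\dim V=2l+1$, $\mathfrak g=\mathfrak{so}(2l+1,\mathbb C)$ ($f_m$ odd). Type (C): $n=2m+1$, $\dim V=2l$, $\mathfrak g=\mathfrak{sp}(2l,\mathbb C)$. Type (D): $n=2m$, $\dim V=2l$, $\mathfrak g=\mathfrak{so}(2l,\mathbb C)$ ($f_m$ even). $\mathfrak g^{-1,1}$ is the space of $g\in\mathfrak g$ with $g(V^{p,q})\subset V^{p-1,q+1}$ for all $p+q=n$; subscripts $B,C,D$ indicate the type. The naturally embedded Grassmannians are those whose tangent spaces at the base point are the blocks of $\mathfrak g^{-1,1}$. Choose a basis of $V_{\mathbb C}$ adapted to the Hodge decomposition, in which $V^{m,m}$ (types (B), (D)) is written as $V_m^1\oplus V_m^2$ (plus a line $L$ in type (B)) with $V_m^1,V_m^2$ maximal isotropic and dual to each other and of dimension $[f_m/2]$. The blocks are: $\mathrm{Hom}(V^{n-k,k},V^{n-k-1,k+1})$ (elements of $\mathfrak g$ being determined by the component together with its $Q$-adjoint) for $0\le k\le m-2$ (and $k=m-1$ in type (C)); $\mathrm{Hom}(V^{m+1,m-1},V_m^1)$ and $\mathrm{Hom}(V^{m+1,m-1},V_m^2)$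 in types (B), (D), all tangent spaces to Grassmannians of type (A), i.e. ordinary Grassmannians; in type (C), the symmetric maps $V^{m+1,m}\to V^{m,m+1}\cong (V^{m+1,m})^*$, tangent space to a Grassmannian of type (C), i.e. a Lagrangian Grassmannian; and in type (B) additionally $\mathrm{Hom}(V^{m+1,m-1},L)$. *)

theory Defs
  imports "HOL-Analysis.Analysis" "HOL-Library.Function_Algebras"
begin

text \<open>The complexification of a real space \<open>'v\<close> is \<open>'v \<times> 'v\<close>, the pair \<open>(x, y)\<close> standing for
  \<open>x + \<i> y\<close>.\<close>

definition cscale :: "complex \<Rightarrow> 'v::real_vector \<times> 'v \<Rightarrow> 'v \<times> 'v" where
  "cscale c z = (Re c *\<^sub>R fst z - Im c *\<^sub>R snd z, Re c *\<^sub>R snd z + Im c *\<^sub>R fst z)"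

definition cconj :: "'v::real_vector \<times> 'v \<Rightarrow> 'v \<times> 'v" where
  "cconj z = (fst z, - snd z)"

definition cext :: "('v::real_vector \<Rightarrow> 'v \<Rightarrow> real) \<Rightarrow> 'v \<times> 'v \<Rightarrow> 'v \<times> 'v \<Rightarrow> complex" where
  "cext Q z w = Complex (Q (fst z) (fst w) - Q (snd z) (snd w)) (Q (fst z) (snd w) + Q (snd z) (fst w))"

global_interpretation cx: vector_space "cscale :: complex \<Rightarrow> 'v::real_vector \<times> 'v \<Rightarrow> 'v \<times> 'v"
  by unfold_locales (auto simp: cscale_def algebra_simps)

definition escale ::
    "complex \<Rightarrow> ('v::real_vector \<times> 'v \<Rightarrow> 'v \<times> 'v) \<Rightarrow> 'v \<times> 'v \<Rightarrow> 'v \<times> 'v" where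
  "escale c X = (\<lambda>z. cscale c (X z))"

global_interpretation endo: vector_space
  "escale :: complex \<Rightarrow> ('v::real_vector \<times> 'v \<Rightarrow> 'v \<times> 'v) \<Rightarrow> 'v \<times> 'v \<Rightarrow> 'v \<times> 'v"
  by unfold_locales
    (auto simp: escale_def fun_eq_iff cx.scale_right_distrib cx.scale_left_distrib)

text \<open>\<open>H p q\<close> is \<open>V\<^sup>p\<^sup>,\<^sup>q\<close>. It is indexed by integers and vanishes unless \<open>p, q \<ge> 0\<close> and
  \<open>p + q = n\<close>, so that shifted indices such as \<open>(p - 1, q + 1)\<close> always make sense.\<close>

definition hodge_structure :: "int \<Rightarrow> (int \<Rightarrow> int \<Rightarrow> ('v::real_vector \<times> 'v) set) \<Rightarrow> bool" where
  "hodge_structure n H \<longleftrightarrow>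
     0 \<le> n \<and>
     (\<forall>p q. cx.subspace (H p q)) \<and>
     (\<forall>p q. p < 0 \<or> q < 0 \<or> p + q \<noteq> n \<longrightarrow> H p q = {0}) \<and>
     bij_betw (\<lambda>u. \<Sum>p\<in>{0..n}. u p) (\<Pi>\<^sub>E p\<in>{0..n}. H p (n - p)) UNIV \<and>
     (\<forall>p q. cconj ` H p q = H q p)"

definition polarisation ::
    "int \<Rightarrow> (int \<Rightarrow> int \<Rightarrow> ('v::real_vector \<times> 'v) set) \<Rightarrow> ('v \<Rightarrow> 'v \<Rightarrow> real) \<Rightarrow> bool" where
  "polarisation n H Q \<longleftrightarrow>
     bilinear Q \<and>
     (\<forall>x y. Q y x = (if even n then Q x y else - Q x y)) \<and>
     (\<forall>p q r s. p + q = n \<longrightarrow> r + s = n \<longrightarrow> (r, s) \<noteq> (q, p) \<longrightarrow>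
        (\<forall>u\<in>H p q. \<forall>v\<in>H r s. cext Q u v = 0)) \<and>
     (\<forall>p q. p + q = n \<longrightarrow> (\<forall>u\<in>H p q. u \<noteq> 0 \<longrightarrow>
        \<i> powi (p - q) * cext Q u (cconj u) \<in> \<real> \<and>
        Re (\<i> powi (p - q) * cext Q u (cconj u)) > 0))"

definition hodge_number :: "int \<Rightarrow> (int \<Rightarrow> int \<Rightarrow> ('v::real_vector \<times> 'v) set) \<Rightarrow> int \<Rightarrow> nat" where
  "hodge_number n H i = cx.dim (H (n - i) i)"

definition isometry_algebra ::
    "('v::real_vector \<Rightarrow> 'v \<Rightarrow> real) \<Rightarrow> ('v \<times> 'v \<Rightarrow> 'v \<times> 'v) set" where
  "isometry_algebra Q =
     {X. Vector_Spaces.linear cscale cscale X \<and>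
         (\<forall>u v. cext Q (X u) v + cext Q u (X v) = 0)}"

definition isometry_group ::
    "('v::real_vector \<Rightarrow> 'v \<Rightarrow> real) \<Rightarrow> ('v \<times> 'v \<Rightarrow> 'v \<times> 'v) set" where
  "isometry_group Q =
     {g. Vector_Spaces.linear cscale cscale g \<and> bij g \<and>
         (\<forall>u v. cext Q (g u) (g v) = cext Q u v)}"

definition isometry_component ::
    "int \<Rightarrow> (int \<Rightarrow> int \<Rightarrow> ('v::real_vector \<times> 'v) set) \<Rightarrow> ('v \<Rightarrow> 'v \<Rightarrow> real) \<Rightarrow> int \<Rightarrow> int \<Rightarrow>
     ('v \<times> 'v \<Rightarrow> 'v \<times> 'v) set" where
  "isometry_component n H Q r s =
     {X \<in> isometry_algebra Q. \<forall>p q. p + q = n \<longrightarrow> X ` H p q \<subseteq> H (p + r) (q + s)}"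

text \<open>The block \<open>Hom (V\<^sup>n\<^sup>-\<^sup>k\<^sup>,\<^sup>k, B)\<close> for a subspace \<open>B\<close> of the next Hodge space: apart from the
  component on \<open>V\<^sup>n\<^sup>-\<^sup>k\<^sup>,\<^sup>k\<close>, only its adjoint, which lives on the dual of the next Hodge space, is
  nonzero. If \<open>n = 2 * k + 1\<close> the two Hodge spaces are dual to each other, the component is its own
  adjoint, and for \<open>B\<close> the whole next Hodge space the block consists of the symmetric maps.\<close>

definition block ::
    "int \<Rightarrow> (int \<Rightarrow> int \<Rightarrow> ('v::real_vector \<times> 'v) set) \<Rightarrow> ('v \<Rightarrow> 'v \<Rightarrow> real) \<Rightarrow> int \<Rightarrow>
     ('v \<times> 'v) set \<Rightarrow> ('v \<times> 'v \<Rightarrow> 'v \<times> 'v) set" where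
  "block n H Q k B =
     {X \<in> isometry_component n H Q (-1) 1.
        X ` H (n - k) k \<subseteq> B \<and>
        (\<forall>p q. p + q = n \<longrightarrow> (p, q) \<noteq> (n - k, k) \<longrightarrow> (p, q) \<noteq> (k + 1, n - k - 1) \<longrightarrow>
           X ` H p q \<subseteq> {0})}"

definition isotropic :: "('v::real_vector \<Rightarrow> 'v \<Rightarrow> real) \<Rightarrow> ('v \<times> 'v) set \<Rightarrow> bool" where
  "isotropic Q S \<longleftrightarrow> (\<forall>u\<in>S. \<forall>v\<in>S. cext Q u v = 0)"

definition maximal_isotropic ::
    "('v::real_vector \<Rightarrow> 'v \<Rightarrow> real) \<Rightarrow> ('v \<times> 'v) set \<Rightarrow> ('v \<times> 'v) set \<Rightarrow> bool" where
  "maximal_isotropic Q W S \<longleftrightarrow>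
     cx.subspace S \<and> S \<subseteq> W \<and> isotropic Q S \<and>
     (\<forall>T. cx.subspace T \<and> S \<subseteq> T \<and> T \<subseteq> W \<and> isotropic Q T \<longrightarrow> T = S)"

definition dual_pair ::
    "('v::real_vector \<Rightarrow> 'v \<Rightarrow> real) \<Rightarrow> ('v \<times> 'v) set \<Rightarrow> ('v \<times> 'v) set \<Rightarrow> bool" where
  "dual_pair Q S T \<longleftrightarrow>
     (\<forall>u\<in>S. u \<noteq> 0 \<longrightarrow> (\<exists>v\<in>T. cext Q u v \<noteq> 0)) \<and>
     (\<forall>v\<in>T. v \<noteq> 0 \<longrightarrow> (\<exists>u\<in>S. cext Q u v \<noteq> 0))"

definition isotropic_splitting ::
    "('v::real_vector \<Rightarrow> 'v \<Rightarrow> real) \<Rightarrow> ('v \<times> 'v) set \<Rightarrow> ('v \<times> 'v) set \<Rightarrow> ('v \<times> 'v) set \<Rightarrow>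
     ('v \<times> 'v) set \<Rightarrow> bool" where
  "isotropic_splitting Q W V1 V2 L \<longleftrightarrow>
     maximal_isotropic Q W V1 \<and> maximal_isotropic Q W V2 \<and> dual_pair Q V1 V2 \<and>
     cx.dim V1 = cx.dim W div 2 \<and> cx.dim V2 = cx.dim W div 2 \<and>
     cx.subspace L \<and> bij_betw (\<lambda>(x, y, z). x + y + z) (V1 \<times> V2 \<times> L) W"

definition perp :: "('v::real_vector \<Rightarrow> 'v \<Rightarrow> real) \<Rightarrow> ('v \<times> 'v) set \<Rightarrow> ('v \<times> 'v) set" where
  "perp Q S = {v. \<forall>u\<in>S. cext Q u v = 0}"

definition hodge_filtration ::
    "int \<Rightarrow> (int \<Rightarrow> int \<Rightarrow> ('v::real_vector \<times> 'v) set) \<Rightarrow> int \<Rightarrow> ('v \<times> 'v) set" where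
  "hodge_filtration n H p = cx.span (\<Union>r\<in>{p..}. H r (n - r))"

text \<open>The compact dual of the period domain. Its base point is the filtration
  \<^term>\<open>hodge_filtration n H\<close>.\<close>

definition compact_dual ::
    "int \<Rightarrow> (int \<Rightarrow> int \<Rightarrow> ('v::real_vector \<times> 'v) set) \<Rightarrow> ('v \<Rightarrow> 'v \<Rightarrow> real) \<Rightarrow>
     (int \<Rightarrow> ('v \<times> 'v) set) set" where
  "compact_dual n H Q =
     {F. \<forall>p. cx.subspace (F p) \<and> cx.dim (F p) = cx.dim (hodge_filtration n H p) \<and>
             F (p + 1) \<subseteq> F p \<and> F (n - p + 1) = perp Q (F p)}"

text \<open>The tangent space at the base point of a set \<open>G\<close> of filtrations, by velocities of curves
  \<open>\<gamma>(t) F\<close> with \<open>\<gamma>\<close> in the isometry group. The tangent space of the compact dual is the quotient of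
  the isometry algebra by the stabiliser of the base point, which is the sum of the components of
  type \<open>(r, -r)\<close> with \<open>r \<ge> 0\<close>; the quotient is represented by the sum of the components with
  \<open>r < 0\<close>.\<close>

definition tangent_space ::
    "int \<Rightarrow> (int \<Rightarrow> int \<Rightarrow> ('v::real_normed_vector \<times> 'v) set) \<Rightarrow> ('v \<Rightarrow> 'v \<Rightarrow> real) \<Rightarrow>
     (int \<Rightarrow> ('v \<times> 'v) set) set \<Rightarrow> ('v \<times> 'v \<Rightarrow> 'v \<times> 'v) set" where
  "tangent_space n H Q G =
     {X \<in> endo.span (\<Union>r\<in>{..<0}. isometry_component n H Q r (- r)).
        \<exists>\<gamma>. \<exists>Y\<in>endo.span (\<Union>r\<in>{0..}. isometry_component n H Q r (- r)).
          \<gamma> (0::real) = id \<and>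
          (\<forall>v. ((\<lambda>t. \<gamma> t v) has_vector_derivative X v + Y v) (at 0)) \<and>
          (\<forall>\<^sub>F t in nhds 0.
             \<gamma> t \<in> isometry_group Q \<and> (\<lambda>p. \<gamma> t ` hodge_filtration n H p) \<in> G)}"

definition grassmannian :: "nat \<Rightarrow> ('v::real_vector \<times> 'v) set \<Rightarrow> ('v \<times> 'v) set set" where
  "grassmannian d W = {S. cx.subspace S \<and> S \<subseteq> W \<and> cx.dim S = d}"

definition lagrangian_grassmannian ::
    "('v::real_vector \<Rightarrow> 'v \<Rightarrow> real) \<Rightarrow> ('v \<times> 'v) set \<Rightarrow> ('v \<times> 'v) set set" where
  "lagrangian_grassmannian Q W =
     {S. cx.subspace S \<and> S \<subseteq> W \<and> isotropic Q S \<and> 2 * cx.dim S = cx.dim W}"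

text \<open>A subspace \<open>S\<close> replaces \<open>V\<^sup>n\<^sup>-\<^sup>k\<^sup>,\<^sup>k\<close> in the Hodge filtration. The step \<open>k + 1\<close> is then forced
  to be the orthogonal complement of the step \<open>n - k\<close>. If \<open>n = 2 * k + 1\<close> these are the same step,
  and \<open>S\<close> has to be Lagrangian.\<close>

definition flag_of ::
    "int \<Rightarrow> (int \<Rightarrow> int \<Rightarrow> ('v::real_vector \<times> 'v) set) \<Rightarrow> ('v \<Rightarrow> 'v \<Rightarrow> real) \<Rightarrow> int \<Rightarrow>
     ('v \<times> 'v) set \<Rightarrow> int \<Rightarrow> ('v \<times> 'v) set" where
  "flag_of n H Q k S p =
     (let E = cx.span (hodge_filtration n H (n - k + 1) \<union> S) in
      if p = n - k then E else if p = k + 1 then perp Q E else hodge_filtration n H p)"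

definition A_grassmannian ::
    "int \<Rightarrow> (int \<Rightarrow> int \<Rightarrow> ('v::real_vector \<times> 'v) set) \<Rightarrow> int \<Rightarrow> ('v \<times> 'v) set \<Rightarrow>
     ('v \<times> 'v) set set" where
  "A_grassmannian n H k B = grassmannian (hodge_number n H k) (cx.span (H (n - k) k \<union> B))"

definition C_grassmannian ::
    "int \<Rightarrow> (int \<Rightarrow> int \<Rightarrow> ('v::real_vector \<times> 'v) set) \<Rightarrow> ('v \<Rightarrow> 'v \<Rightarrow> real) \<Rightarrow> int \<Rightarrow>
     ('v \<times> 'v) set set" where
  "C_grassmannian n H Q k =
     lagrangian_grassmannian Q (cx.span (H (n - k) k \<union> H (n - k - 1) (k + 1)))"

definition naturally_embedded ::
    "int \<Rightarrow> (int \<Rightarrow> int \<Rightarrow> ('v::real_normed_vector \<times> 'v) set) \<Rightarrow> ('v \<Rightarrow> 'v \<Rightarrow> real) \<Rightarrow> int \<Rightarrow>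
     ('v \<times> 'v) set \<Rightarrow> ('v \<times> 'v) set set \<Rightarrow> bool" where
  "naturally_embedded n H Q k B G \<longleftrightarrow>
     inj_on (flag_of n H Q k) G \<and> flag_of n H Q k ` G \<subseteq> compact_dual n H Q \<and>
     tangent_space n H Q (flag_of n H Q k ` G) = block n H Q k B"

text \<open>The Grassmannians are homogeneous, so their dimension is that of the tangent space at the base
  point.\<close>

definition embedded_dim ::
    "int \<Rightarrow> (int \<Rightarrow> int \<Rightarrow> ('v::real_normed_vector \<times> 'v) set) \<Rightarrow> ('v \<Rightarrow> 'v \<Rightarrow> real) \<Rightarrow> int \<Rightarrow>
     ('v \<times> 'v) set set \<Rightarrow> nat" where
  "embedded_dim n H Q k G = endo.dim (tangent_space n H Q (flag_of n H Q k ` G))"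

end

theory Submission
  imports Defs
begin

text \<open>Let \<open>\<beta>\<close> be the complex bilinear extension of \<open>Q\<close> and \<open>V\<^sup>p = V\<^sup>p\<^sup>,\<^sup>n\<^sup>-\<^sup>p\<close>. The
  polarisation makes \<open>\<beta>\<close> nondegenerate and pairs \<open>V\<^sup>p\<close> with \<open>V\<^sup>n\<^sup>-\<^sup>p\<close> only.

  The dimensions are counts of matrix entries. Take a basis \<open>I\<close> of the complexification and the
  \<open>\<beta>\<close>-dual basis \<open>d\<close>. An infinitesimal isometry \<open>X\<close> is determined by the numbers
  \<open>\<beta> (X (d i)) (d j)\<close>, and these form an arbitrary matrix that is antisymmetric for \<open>n\<close> even and
  symmetric for \<open>n\<close> odd. Let \<open>I\<close> be adapted to the Hodge decomposition and to a subspace \<open>B\<close> of a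
  Hodge space. Then \<open>\<g>\<^sup>-\<^sup>1\<^sup>,\<^sup>1\<close> and the block \<open>Hom (V\<^sup>n\<^sup>-\<^sup>k, B)\<close> are cut out by the vanishing of the entries
  outside a symmetric set of positions, so their dimension is the number of unordered pairs in this
  set (\<open>dim_supported\<close>). The positions of a block are the pairs of a basis vector of \<open>V\<^sup>k\<close> and one
  of \<open>B\<close>, which gives \<open>f\<^sub>k * dim B\<close>. If \<open>n = 2 * k + 1\<close> and \<open>B = V\<^sup>k\<close>, both vectors come from
  the same set of \<open>f\<^sub>k\<close> vectors, which gives \<open>f\<^sub>k * (f\<^sub>k + 1) / 2\<close>. For \<open>\<g>\<^sup>-\<^sup>1\<^sup>,\<^sup>1\<close> all pairs in
  \<open>V\<^sup>p \<times> V\<^sup>n\<^sup>-\<^sup>1\<^sup>-\<^sup>p\<close> occur, and counting each unordered pair once leaves the terms with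
  \<open>p \<le> n - 1 - p\<close>.

  Both kinds of Grassmannians consist of the isotropic subspaces \<open>S\<close> of \<open>V\<^sup>n\<^sup>-\<^sup>k + B\<close> of dimension
  \<open>f\<^sub>k\<close>. Replacing the step \<open>F\<^sup>n\<^sup>-\<^sup>k\<close> of the Hodge filtration by \<open>E = F\<^sup>n\<^sup>-\<^sup>k\<^sup>+\<^sup>1 + S\<close> and \<open>F\<^sup>k\<^sup>+\<^sup>1\<close> by
  the orthogonal complement of \<open>E\<close> gives a point of the compact dual, since \<open>E\<close> is isotropic and
  has the dimension of \<open>F\<^sup>n\<^sup>-\<^sup>k\<close>. An element \<open>X\<close> of the block has square zero, hence \<open>1 + t X\<close> is an
  isometry, and it moves the base point inside the Grassmannian; so the block is tangent
  (\<open>block_subset_tangent\<close>). Conversely, a curve that stays in a subspace has its velocity there.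
  Applied to the steps of the flags, which are constant except for \<open>F\<^sup>n\<^sup>-\<^sup>k\<close> and \<open>F\<^sup>k\<^sup>+\<^sup>1\<close>, this
  forces the negative part \<open>X\<close> of a velocity to vanish on \<open>V\<^sup>p\<close> for \<open>p\<close> different from \<open>n - k\<close> and
  \<open>k + 1\<close> and to map \<open>V\<^sup>n\<^sup>-\<^sup>k\<close> into \<open>B\<close>; so the tangent space is the block
  (\<open>tangent_subset_block\<close>).

  For the halves of the middle Hodge space, the splitting \<open>V\<^sub>m\<^sup>1 + V\<^sub>m\<^sup>2 + L\<close> yields
  \<open>f\<^sub>m = 2 * dim B + dim L\<close>, which turns \<open>f\<^sub>m\<^sub>-\<^sub>1 * dim B\<close> into the stated halves.\<close>

section \<open>Dimension counts by coordinates\<close>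

text \<open>A dimension count that works inside an infinite-dimensional space, such as the space of all
  self-maps of the complexification: dual functionals make \<open>E\<close> independent, and joint injectivity
  on \<open>S\<close> makes it spanning.\<close>

lemma (in vector_space) dim_eq_card_coordinates:
  assumes fin: "finite P" and S: "subspace S" and E: "\<And>p. p \<in> P \<Longrightarrow> E p \<in> S"
    and add: "\<And>p x y. \<phi> p (x + y) = \<phi> p x + \<phi> p y"
    and scl: "\<And>p c x. \<phi> p (scale c x) = c * \<phi> p x"
    and dual: "\<And>p q. p \<in> P \<Longrightarrow> q \<in> P \<Longrightarrow> \<phi> p (E q) = (if p = q then 1 else 0)"
    and sep: "\<And>x. x \<in> S \<Longrightarrow> \<forall>p\<in>P. \<phi> p x = 0 \<Longrightarrow> x = 0"
  shows "dim S = card P"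
proof -
  have zero: "\<phi> p 0 = 0" for p
    using scl[of p 0 0] by simp
  have sum: "\<phi> p (sum g A) = (\<Sum>a\<in>A. \<phi> p (g a))" if "finite A" for p A and g :: "'z \<Rightarrow> 'b"
    using that by induction (auto simp: zero add)
  have inj: "inj_on E P"
    by (rule inj_onI) (metis dual zero_neq_one)
  have "independent (E ` P)"
  proof (rule independent_if_scalars_zero)
    fix c x assume eq: "(\<Sum>x\<in>E ` P. scale (c x) x) = 0" and "x \<in> E ` P"
    then obtain p where p: "p \<in> P" "x = E p" by auto
    have "0 = \<phi> p (\<Sum>q\<in>P. scale (c (E q)) (E q))"
      using eq by (simp add: sum.reindex[OF inj] zero)
    also have "\<dots> = (\<Sum>q\<in>P. if p = q then c (E q) else 0)"
      unfolding sum[OF fin] by (rule sum.cong) (auto simp: scl dual p)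
    also have "\<dots> = c (E p)" using p fin by simp
    finally show "c x = 0" using p by simp
  qed (use fin in simp)
  moreover have "S \<subseteq> span (E ` P)"
  proof
    fix x assume x: "x \<in> S"
    define y where "y = (\<Sum>q\<in>P. scale (\<phi> q x) (E q))"
    have y: "y \<in> span (E ` P)"
      unfolding y_def by (intro span_sum span_scale span_base) simp
    have yS: "y \<in> S"
      unfolding y_def by (auto intro!: subspace_sum subspace_scale S E)
    have "\<phi> p (x - y) = 0" if p: "p \<in> P" for p
    proof -
      have "\<phi> p y = (\<Sum>q\<in>P. if p = q then \<phi> q x else 0)"
        unfolding y_def sum[OF fin] by (rule sum.cong) (auto simp: scl dual p)
      also have "\<dots> = \<phi> p x" using p fin by simp
      finally show ?thesis using add[of p "x - y" y] by simp
    qed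
    then have "x = y" using sep[of "x - y"] x yS S by (auto simp: subspace_diff)
    then show "x \<in> span (E ` P)" using y by simp
  qed
  ultimately show ?thesis
    using E by (intro dim_unique[where B = "E ` P"]) (auto simp: card_image[OF inj])
qed

text \<open>The injection \<open>h\<close> replaces a linear order, so that the pairs with \<open>h i \<le> h j\<close> represent each
  unordered pair once. The set and its converse cover the square and meet in the diagonal.\<close>

lemma card_triangle:
  fixes h :: "'a \<Rightarrow> nat"
  assumes fin: "finite J" and h: "inj_on h J"
  shows "2 * card {(i, j) \<in> J \<times> J. h i \<le> h j} = card J * (card J + 1)"
proof -
  let ?T = "{(i, j) \<in> J \<times> J. h i \<le> h j}"
  have "finite (J \<times> J)" using fin by simp
  then have finT: "finite ?T" by (rule rev_finite_subset) auto
  have "?T \<union> ?T\<inverse> = J \<times> J" by auto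
  moreover have "?T \<inter> ?T\<inverse> = (\<lambda>i. (i, i)) ` J" using inj_onD[OF h] by fastforce
  moreover have "card (?T\<inverse>) = card ?T" by (rule card_inverse)
  moreover have "card ((\<lambda>i. (i, i)) ` J) = card J" by (rule card_image) (simp add: inj_on_def)
  moreover have "card ?T + card (?T\<inverse>) = card (?T \<union> ?T\<inverse>) + card (?T \<inter> ?T\<inverse>)"
    by (rule card_Un_Int) (use finT in auto)
  ultimately show ?thesis by (simp add: card_cartesian_product)
qed

section \<open>The complexification\<close>

definition real_basis :: "('v::euclidean_space \<times> 'v) set" where
  "real_basis = (\<lambda>b. (b, 0)) ` Basis"

lemma real_basis_expansion:
  fixes z :: "'v::euclidean_space \<times> 'v"
  shows "(\<Sum>b\<in>Basis. cscale (Complex (fst z \<bullet> b) (snd z \<bullet> b)) (b, 0)) = z"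
  by (rule prod_eqI) (simp_all add: cscale_def fst_sum snd_sum euclidean_representation)

global_interpretation cxf: finite_dimensional_vector_space
  "cscale :: complex \<Rightarrow> 'v::euclidean_space \<times> 'v \<Rightarrow> 'v \<times> 'v" real_basis
proof unfold_locales
  show "finite (real_basis :: ('v \<times> 'v) set)" by (simp add: real_basis_def)
  have inj: "inj_on (\<lambda>b. (b, 0)) (Basis :: 'v set)" by (simp add: inj_on_def)
  show "cx.independent (real_basis :: ('v \<times> 'v) set)"
  proof (rule cx.independent_if_scalars_zero)
    fix c :: "'v \<times> 'v \<Rightarrow> complex" and x :: "'v \<times> 'v"
    assume eq: "(\<Sum>x\<in>real_basis. cscale (c x) x) = 0" and "x \<in> real_basis"
    then obtain b where b: "b \<in> Basis" "x = (b, 0)" by (auto simp: real_basis_def)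
    have *: "(\<Sum>b\<in>Basis. Re (c (b, 0)) *\<^sub>R b) = (0::'v)" "(\<Sum>b\<in>Basis. Im (c (b, 0)) *\<^sub>R b) = (0::'v)"
      using eq unfolding real_basis_def sum.reindex[OF inj]
      by (auto simp: cscale_def prod_eq_iff fst_sum snd_sum)
    have "Re (c x) = 0" "Im (c x) = 0"
      using arg_cong[OF *(1), of "\<lambda>v. v \<bullet> b"] arg_cong[OF *(2), of "\<lambda>v. v \<bullet> b"] b
      by (auto simp: inner_sum_left_Basis)
    then show "c x = 0" by (simp add: complex_eq_iff)
  qed (simp add: real_basis_def)
  show "cx.span (real_basis :: ('v \<times> 'v) set) = UNIV"
  proof (rule UNIV_eq_I[symmetric])
    fix z :: "'v \<times> 'v"
    show "z \<in> cx.span real_basis"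
      by (subst real_basis_expansion[symmetric])
        (intro cx.span_sum cx.span_scale cx.span_base, simp add: real_basis_def)
  qed
qed

global_interpretation cxp: finite_dimensional_vector_space_pair
  "cscale :: complex \<Rightarrow> 'v::euclidean_space \<times> 'v \<Rightarrow> 'v \<times> 'v" real_basis
  "cscale :: complex \<Rightarrow> 'v::euclidean_space \<times> 'v \<Rightarrow> 'v \<times> 'v" real_basis
  by unfold_locales

lemma dim_span_Un_disjoint:
  fixes S T :: "('v::euclidean_space \<times> 'v) set"
  assumes "cx.subspace S" "cx.subspace T" "S \<inter> T \<subseteq> {0}"
  shows "cx.dim (cx.span (S \<union> T)) = cx.dim S + cx.dim T"
proof -
  have "S \<inter> T = {0}" using assms cx.subspace_0 by blast
  then have "cx.dim (S \<inter> T) = 0" by simp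
  moreover have "cx.span (S \<union> T) = {x + y |x y. x \<in> S \<and> y \<in> T}"
    using assms by (simp add: cx.span_Un cx.span_eq_iff[THEN iffD2])
  ultimately show ?thesis using cxf.dim_sums_Int[OF assms(1,2)] by (simp only: add_0_right)
qed

lemma scaleR_eq_cscale: "t *\<^sub>R z = cscale (of_real t) z"
  by (cases z) (simp add: cscale_def)

lemma closed_complex_subspace:
  fixes S :: "('v::euclidean_space \<times> 'v) set"
  assumes "cx.subspace S"
  shows "closed S"
  by (rule closed_subspace, rule subspaceI)
    (use assms in \<open>auto simp: scaleR_eq_cscale cx.subspace_0 cx.subspace_add cx.subspace_scale\<close>)

text \<open>The difference quotients lie in the subspace, which is closed.\<close>

lemma velocity_in_subspace:
  fixes S :: "('v::euclidean_space \<times> 'v) set"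
  assumes S: "cx.subspace S" and d: "(g has_vector_derivative D) (at 0)"
    and ev: "\<forall>\<^sub>F t in nhds 0. g t \<in> S"
  shows "D \<in> S"
proof -
  have g0: "g 0 \<in> S" using ev by (rule eventually_nhds_x_imp_x)
  have "((\<lambda>h. norm (g h - g 0 - h *\<^sub>R D) / norm h) \<longlongrightarrow> 0) (at 0)"
    using d by (simp add: has_vector_derivative_def has_derivative_at)
  moreover have "\<forall>\<^sub>F h in at 0.
      norm (g h - g 0 - h *\<^sub>R D) / norm h = norm (inverse h *\<^sub>R (g h - g 0) - D)"
  proof (rule eventually_at_ball'[OF zero_less_one, THEN eventually_mono])
    fix h :: real assume "h \<in> ball 0 1 \<and> h \<noteq> 0 \<and> h \<in> UNIV"
    then have "inverse h *\<^sub>R (g h - g 0) - D = inverse h *\<^sub>R (g h - g 0 - h *\<^sub>R D)"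
      by (simp add: scaleR_diff_right)
    then show "norm (g h - g 0 - h *\<^sub>R D) / norm h = norm (inverse h *\<^sub>R (g h - g 0) - D)"
      by (simp add: divide_inverse_commute)
  qed
  ultimately have "((\<lambda>h. norm (inverse h *\<^sub>R (g h - g 0) - D)) \<longlongrightarrow> 0) (at 0)"
    by (rule Lim_transform_eventually)
  then have "((\<lambda>h. inverse h *\<^sub>R (g h - g 0)) \<longlongrightarrow> D) (at 0)"
    using Lim_null tendsto_norm_zero_iff by blast
  moreover have "\<forall>\<^sub>F h in at 0. inverse h *\<^sub>R (g h - g 0) \<in> S"
    unfolding eventually_at_filter using ev
    by (rule eventually_mono) (auto simp: scaleR_eq_cscale cx.subspace_diff cx.subspace_scale S g0)
  ultimately show ?thesis
    by (intro Lim_in_closed_set[OF closed_complex_subspace[OF S]]) auto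
qed

section \<open>Hodge decomposition and polarisation\<close>

lemma clinearI:
  assumes "\<And>x y. X (x + y) = X x + X y" and "\<And>c x. X (cscale c x) = cscale c (X x)"
  shows "Vector_Spaces.linear cscale cscale X"
  using assms by (simp add: Vector_Spaces.linear_iff cx.vector_space_axioms)

lemma cext_add_left:
  "bilinear Q \<Longrightarrow> cext Q (x + y) z = cext Q x z + cext Q y z"
  by (simp add: cext_def bilinear_ladd bilinear_radd complex_eq_iff)

lemma cext_add_right:
  "bilinear Q \<Longrightarrow> cext Q x (y + z) = cext Q x y + cext Q x z"
  by (simp add: cext_def bilinear_ladd bilinear_radd complex_eq_iff)

lemma cext_scale_left:
  "bilinear Q \<Longrightarrow> cext Q (cscale c x) y = c * cext Q x y"
  by (simp add: cext_def cscale_def bilinear_ladd bilinear_radd bilinear_lmul bilinear_rmul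
      bilinear_lsub bilinear_rsub complex_eq_iff algebra_simps)

lemma cext_scale_right:
  "bilinear Q \<Longrightarrow> cext Q x (cscale c y) = c * cext Q x y"
  by (simp add: cext_def cscale_def bilinear_ladd bilinear_radd bilinear_lmul bilinear_rmul
      bilinear_lsub bilinear_rsub complex_eq_iff algebra_simps)

locale polarised_hodge_structure =
  fixes n :: int and H :: "int \<Rightarrow> int \<Rightarrow> ('v::euclidean_space \<times> 'v) set"
    and Q :: "'v \<Rightarrow> 'v \<Rightarrow> real"
  assumes hodge: "hodge_structure n H" and pol: "polarisation n H Q"
begin

abbreviation \<beta> :: "'v \<times> 'v \<Rightarrow> 'v \<times> 'v \<Rightarrow> complex" where "\<beta> \<equiv> cext Q"

definition piece :: "int \<Rightarrow> ('v \<times> 'v) set" where "piece p = H p (n - p)"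

text \<open>The sign of the symmetry \<open>\<beta> v u = \<plusminus> \<beta> u v\<close>; it allows one treatment of both parities.\<close>

definition sgn_n :: complex where "sgn_n = (if even n then 1 else - 1)"

lemma H_eq_piece: "p + q = n \<Longrightarrow> H p q = piece p"
  by (auto simp: piece_def)

lemma bil: "bilinear Q" using pol by (simp add: polarisation_def)

lemmas \<beta>_add_left = cext_add_left[OF bil]
  and \<beta>_add_right = cext_add_right[OF bil]
  and \<beta>_scale_left = cext_scale_left[OF bil]
  and \<beta>_scale_right = cext_scale_right[OF bil]

lemma \<beta>_zero [simp]: "\<beta> 0 v = 0" "\<beta> v 0 = 0"
  using \<beta>_scale_left[of 0 0 v] \<beta>_scale_right[of v 0 0] by simp_all

lemma \<beta>_diff_left: "\<beta> (x - y) z = \<beta> x z - \<beta> y z"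
  using \<beta>_add_left[of "x - y" y z] by simp

lemma \<beta>_diff_right: "\<beta> x (y - z) = \<beta> x y - \<beta> x z"
  using \<beta>_add_right[of x "y - z" z] by simp

lemma \<beta>_sum_left: "\<beta> (sum g A) v = (\<Sum>a\<in>A. \<beta> (g a) v)"
  by (induction A rule: infinite_finite_induct) (auto simp: \<beta>_add_left)

lemma \<beta>_sum_right: "\<beta> v (sum g A) = (\<Sum>a\<in>A. \<beta> v (g a))"
  by (induction A rule: infinite_finite_induct) (auto simp: \<beta>_add_right)

lemma sgn_n_cases: "sgn_n = 1 \<or> sgn_n = - 1" by (simp add: sgn_n_def)

lemma \<beta>_sym: "\<beta> v u = sgn_n * \<beta> u v"
proof -
  define s where "s = (if even n then 1 else - 1 :: real)"
  have Q: "Q y x = s * Q x y" for x y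
  proof -
    have "\<forall>x y. Q y x = (if even n then Q x y else - Q x y)"
      using pol unfolding polarisation_def by (elim conjE)
    from this[THEN spec, THEN spec, of x y] show ?thesis unfolding s_def by (cases "even n") (simp_all only: if_True if_False mult_1 mult_minus1)
  qed
  have "\<beta> v u = of_real s * \<beta> u v"
    unfolding cext_def Q[of "fst v" "fst u"] Q[of "snd v" "snd u"] Q[of "fst v" "snd u"]
      Q[of "snd v" "fst u"]
    by (simp add: complex_eq_iff algebra_simps)
  then show ?thesis by (simp add: s_def sgn_n_def)
qed

lemma \<beta>_eq_0_sym: "\<beta> v u = 0 \<longleftrightarrow> \<beta> u v = 0"
  by (metis \<beta>_sym mult_zero_right)

lemma subspace_piece: "cx.subspace (piece p)"
  using hodge by (simp add: hodge_structure_def piece_def)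

lemma piece_outside: "p \<notin> {0..n} \<Longrightarrow> piece p = {0}"
  using hodge by (auto simp: hodge_structure_def piece_def)

lemma cconj_piece: "u \<in> piece p \<Longrightarrow> cconj u \<in> piece (n - p)"
proof -
  have "cconj ` H p (n - p) = H (n - p) p" using hodge unfolding hodge_structure_def by blast
  then show "u \<in> piece p \<Longrightarrow> cconj u \<in> piece (n - p)" by (auto simp: piece_def)
qed

lemma piece_orthogonal:
  assumes "u \<in> piece p" "v \<in> piece r" "p + r \<noteq> n"
  shows "\<beta> u v = 0"
proof -
  have "\<forall>p q r s. p + q = n \<longrightarrow> r + s = n \<longrightarrow> (r, s) \<noteq> (q, p) \<longrightarrow>
        (\<forall>u\<in>H p q. \<forall>v\<in>H r s. cext Q u v = 0)"
    using pol unfolding polarisation_def by blast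
  from this[rule_format, of p "n - p" r "n - r" u v] show ?thesis
    using assms by (auto simp: piece_def)
qed

text \<open>What nondegeneracy needs of the polarisation inequality, free of signs and powers of \<open>\<i>\<close>.\<close>

lemma piece_definite:
  assumes "u \<in> piece p" "\<beta> u (cconj u) = 0"
  shows "u = 0"
proof (rule ccontr)
  assume "u \<noteq> 0"
  moreover have "\<forall>p q. p + q = n \<longrightarrow> (\<forall>u\<in>H p q. u \<noteq> 0 \<longrightarrow>
        Re (\<i> powi (p - q) * cext Q u (cconj u)) > 0)"
    using pol unfolding polarisation_def by blast
  note this[rule_format, of p "n - p" u]
  ultimately have "Re (\<i> powi (p - (n - p)) * \<beta> u (cconj u)) > 0"
    using assms(1) by (simp add: piece_def del: times_complex.sel)
  then show False using assms(2) by simp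
qed

text \<open>The projections of the Hodge decomposition, extended by zero to the indices outside
  \<open>{0..n}\<close>, where the pieces vanish; sums over degrees then need no case distinction.\<close>

definition proj :: "int \<Rightarrow> 'v \<times> 'v \<Rightarrow> 'v \<times> 'v" where
  "proj p v = (if p \<in> {0..n}
     then inv_into (\<Pi>\<^sub>E p\<in>{0..n}. piece p) (\<lambda>u. \<Sum>p\<in>{0..n}. u p) v p else 0)"

lemma proj_outside: "p \<notin> {0..n} \<Longrightarrow> proj p v = 0"
  unfolding proj_def by (rule if_not_P)

lemma decomposition_bij:
  "bij_betw (\<lambda>u. \<Sum>p\<in>{0..n}. u p) (\<Pi>\<^sub>E p\<in>{0..n}. piece p) UNIV"
  using hodge by (simp add: hodge_structure_def piece_def)

lemma proj_mem: "proj p v \<in> piece p"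
proof (cases "p \<in> {0..n}")
  case True
  have "inv_into (\<Pi>\<^sub>E p\<in>{0..n}. piece p) (\<lambda>u. \<Sum>p\<in>{0..n}. u p) v \<in> (\<Pi>\<^sub>E p\<in>{0..n}. piece p)"
    using decomposition_bij by (intro inv_into_into) (simp add: bij_betw_def)
  then show ?thesis using True by (auto simp: proj_def)
next
  case False
  then show ?thesis by (simp add: proj_outside cx.subspace_0 subspace_piece del: atLeastAtMost_iff)
qed

lemma sum_proj: "(\<Sum>p\<in>{0..n}. proj p v) = v"
proof -
  have "v \<in> (\<lambda>u. \<Sum>p\<in>{0..n}. u p) ` (\<Pi>\<^sub>E p\<in>{0..n}. piece p)"
    using decomposition_bij unfolding bij_betw_def by blast
  from f_inv_into_f[OF this] show ?thesis by (simp add: proj_def)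
qed

lemma proj_unique:
  assumes u: "\<And>p. p \<in> {0..n} \<Longrightarrow> u p \<in> piece p" and v: "v = (\<Sum>p\<in>{0..n}. u p)"
    and p: "p \<in> {0..n}"
  shows "proj p v = u p"
proof -
  let ?u = "restrict u {0..n}" and ?w = "restrict (\<lambda>p. proj p v) {0..n}"
  have "(\<Sum>p\<in>{0..n}. ?u p) = (\<Sum>p\<in>{0..n}. ?w p)"
    using v sum_proj[of v] by simp
  moreover have "?u \<in> (\<Pi>\<^sub>E p\<in>{0..n}. piece p)" "?w \<in> (\<Pi>\<^sub>E p\<in>{0..n}. piece p)"
    using u proj_mem by auto
  ultimately have "?u = ?w"
    using decomposition_bij unfolding bij_betw_def inj_on_def by blast
  from fun_cong[OF this, of p] show ?thesis using p by simp
qed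

lemma proj_add: "proj p (x + y) = proj p x + proj p y"
proof (cases "p \<in> {0..n}")
  case True
  then show ?thesis
    by (intro proj_unique[where u = "\<lambda>p. proj p x + proj p y"])
      (simp_all add: proj_mem cx.subspace_add subspace_piece sum.distrib sum_proj)
qed (simp add: proj_outside del: atLeastAtMost_iff)

lemma proj_scale: "proj p (cscale c x) = cscale c (proj p x)"
proof (cases "p \<in> {0..n}")
  case True
  then show ?thesis
    by (intro proj_unique[where u = "\<lambda>p. cscale c (proj p x)"])
      (simp_all add: proj_mem cx.subspace_scale subspace_piece
        cx.scale_sum_right[symmetric] sum_proj)
qed (simp add: proj_outside del: atLeastAtMost_iff)

lemma proj_zero [simp]: "proj p 0 = 0"
  using proj_scale[of p 0 0] by simp

lemma proj_diff: "proj p (x - y) = proj p x - proj p y"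
  using proj_add[of p "x - y" y] by simp

lemma proj_sum: "proj p (sum g A) = (\<Sum>a\<in>A. proj p (g a))"
  by (induction A rule: infinite_finite_induct) (auto simp: proj_add)

lemma proj_piece:
  assumes "v \<in> piece r"
  shows "proj p v = (if p = r then v else 0)"
proof (cases "p \<in> {0..n}")
  case True
  then show ?thesis
    using assms piece_outside[of r] by (intro proj_unique[where u = "\<lambda>p. if p = r then v else 0"])
      (auto simp: cx.subspace_0 subspace_piece)
next
  case False
  then show ?thesis using assms piece_outside[of p] by (auto simp: proj_outside)
qed

text \<open>Only one component of \<open>v\<close> has the type that pairs with \<open>piece r\<close>.\<close>

lemma \<beta>_proj:
  assumes "w \<in> piece r"
  shows "\<beta> v w = \<beta> (proj (n - r) v) w" "\<beta> w v = \<beta> w (proj (n - r) v)"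
proof -
  show "\<beta> v w = \<beta> (proj (n - r) v) w"
  proof (cases "n - r \<in> {0..n}")
    case True
    have "\<beta> v w = (\<Sum>p\<in>{0..n}. \<beta> (proj p v) w)"
      by (subst sum_proj[of v, symmetric]) (rule \<beta>_sum_left)
    also have "\<dots> = (\<Sum>p\<in>{0..n}. if p = n - r then \<beta> (proj p v) w else 0)"
      using piece_orthogonal[OF proj_mem assms] by (intro sum.cong) auto
    finally show ?thesis using True by simp
  next
    case False
    then have "w = 0" using assms piece_outside[of r] by auto
    then show ?thesis by simp
  qed
  then show "\<beta> w v = \<beta> w (proj (n - r) v)"
    using \<beta>_sym[of w v] \<beta>_sym[of w "proj (n - r) v"] by simp
qed

text \<open>The pairing of \<open>piece p\<close> with \<open>piece (n - p)\<close> is perfect, because the complex conjugate of a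
  nonzero vector of the first lies in the second and pairs with it to a nonzero number.\<close>

lemma proj_eq_0I:
  assumes "\<And>w. w \<in> piece (n - p) \<Longrightarrow> \<beta> v w = 0"
  shows "proj p v = 0"
proof (rule piece_definite[OF proj_mem])
  have w: "cconj (proj p v) \<in> piece (n - p)" by (rule cconj_piece[OF proj_mem])
  show "\<beta> (proj p v) (cconj (proj p v)) = 0"
    using assms[OF w] \<beta>_proj(1)[OF w, of v] by simp
qed

lemma nondegenerate:
  assumes "\<And>w. \<beta> v w = 0"
  shows "v = 0"
proof -
  have "(\<Sum>p\<in>{0..n}. proj p v) = 0" using assms by (intro sum.neutral) (auto intro: proj_eq_0I)
  then show ?thesis by (simp add: sum_proj)
qed

lemma mem_piece_iff: "v \<in> piece p \<longleftrightarrow> (\<forall>r. r \<noteq> p \<longrightarrow> proj r v = 0)"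
proof
  assume *: "\<forall>r. r \<noteq> p \<longrightarrow> proj r v = 0"
  have "v = (\<Sum>r\<in>{0..n}. if r = p then proj r v else 0)"
    using * by (subst sum_proj[of v, symmetric], intro sum.cong) auto
  also have "\<dots> \<in> piece p"
    by (intro cx.subspace_sum[OF subspace_piece]) (simp add: proj_mem cx.subspace_0[OF subspace_piece])
  finally show "v \<in> piece p" .
qed (auto simp: proj_piece)

section \<open>Dual bases\<close>

definition dual_bases :: "('v \<times> 'v) set \<Rightarrow> ('v \<times> 'v \<Rightarrow> 'v \<times> 'v) \<Rightarrow> bool" where
  "dual_bases I d \<longleftrightarrow> cx.independent I \<and> cx.span I = UNIV \<and> finite I \<and>
     (\<forall>i\<in>I. \<forall>j\<in>I. \<beta> i (d j) = (if i = j then 1 else 0))"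

text \<open>Nondegeneracy makes \<open>v \<mapsto> \<Sum>i. \<beta> i v \<cdot> i\<close> injective, hence bijective; \<open>d j\<close> is the preimage of
  \<open>j\<close>.\<close>

lemma dual_basis_exists:
  assumes ind: "cx.independent I" and sp: "cx.span I = UNIV"
  shows "\<exists>d. dual_bases I d"
proof -
  have fin: "finite I" using ind by (rule cxf.finiteI_independent)
  define T where "T v = (\<Sum>i\<in>I. cscale (\<beta> i v) i)" for v
  have lin: "Vector_Spaces.linear cscale cscale T"
    unfolding T_def
    by (intro clinearI) (simp_all add: \<beta>_add_right \<beta>_scale_right cx.scale_left_distrib sum.distrib
        cx.scale_sum_right)
  have ker: "v = 0" if "T v = 0" for v
  proof -
    have orth: "\<beta> i v = 0" if "i \<in> I" for i
      using cx.independentD[OF ind fin order_refl, of "\<lambda>i. \<beta> i v" i] \<open>T v = 0\<close> that unfolding T_def by blast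
    have "\<beta> w v = 0" if "w \<in> cx.span I" for w
      using that by (induction rule: cx.span_induct_alt) (auto simp: \<beta>_add_left \<beta>_scale_left orth)
    then show ?thesis using sp by (intro nondegenerate) (auto simp: \<beta>_eq_0_sym)
  qed
  have "inj T" using ker by (auto simp: cxp.linear_inj_iff_eq_0[OF lin])
  then have "surj T" using cxp.linear_injective_imp_surjective[OF lin] by blast
  then have T_inv: "T (inv T j) = j" for j by (rule surj_f_inv_f)
  have "\<beta> i (inv T j) = (if i = j then 1 else 0)" if ij: "i \<in> I" "j \<in> I" for i j
  proof -
    have "(\<Sum>i\<in>I. cscale (\<beta> i (inv T j) - (if i = j then 1 else 0)) i)
        = T (inv T j) - (\<Sum>i\<in>I. if i = j then i else 0)"
      by (simp add: T_def cx.scale_left_diff_distrib sum_subtractf if_distrib[of "\<lambda>c. cscale c _"]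
          cong: if_cong)
    also have "\<dots> = 0" using fin ij by (simp add: T_inv)
    finally have "\<beta> i (inv T j) - (if i = j then 1 else 0) = 0"
      by (rule cx.independentD[OF ind fin order_refl _ ij(1)])
    then show ?thesis by simp
  qed
  then show ?thesis using assms fin unfolding dual_bases_def by blast
qed

context
  fixes I d assumes D: "dual_bases I d"
begin

lemma dual_finite: "finite I" using D by (simp add: dual_bases_def)

lemma dual_\<beta>: "i \<in> I \<Longrightarrow> j \<in> I \<Longrightarrow> \<beta> i (d j) = (if i = j then 1 else 0)"
  using D by (simp add: dual_bases_def)

lemma zero_if_orthogonal_to_basis:
  assumes "\<And>i. i \<in> I \<Longrightarrow> \<beta> i v = 0"
  shows "v = 0"
proof (rule nondegenerate)
  have "\<beta> w v = 0" if "w \<in> cx.span I" for w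
    using that by (induction rule: cx.span_induct_alt) (auto simp: \<beta>_add_left \<beta>_scale_left assms)
  then show "\<beta> v w = 0" for w using D \<beta>_eq_0_sym[of v w] by (auto simp: dual_bases_def)
qed

lemma expand_in_dual: "v = (\<Sum>i\<in>I. cscale (\<beta> i v) (d i))"
proof -
  have "v - (\<Sum>i\<in>I. cscale (\<beta> i v) (d i)) = 0"
  proof (rule zero_if_orthogonal_to_basis)
    fix j assume j: "j \<in> I"
    have "\<beta> j (\<Sum>i\<in>I. cscale (\<beta> i v) (d i)) = (\<Sum>i\<in>I. if j = i then \<beta> i v else 0)"
      unfolding \<beta>_sum_right using j by (intro sum.cong) (auto simp: \<beta>_scale_right dual_\<beta>)
    then show "\<beta> j (v - (\<Sum>i\<in>I. cscale (\<beta> i v) (d i))) = 0"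
      using j dual_finite by (simp add: \<beta>_diff_right)
  qed
  then show ?thesis by simp
qed

lemma expand_in_basis: "v = (\<Sum>i\<in>I. cscale (\<beta> v (d i)) i)"
proof -
  have "v - (\<Sum>i\<in>I. cscale (\<beta> v (d i)) i) = 0"
  proof (rule nondegenerate)
    fix w
    have "\<beta> v w = \<beta> v (\<Sum>i\<in>I. cscale (\<beta> i w) (d i))" using expand_in_dual[of w] by simp
    also have "\<dots> = \<beta> (\<Sum>i\<in>I. cscale (\<beta> v (d i)) i) w"
      by (simp add: \<beta>_sum_right \<beta>_sum_left \<beta>_scale_right \<beta>_scale_left mult.commute)
    finally show "\<beta> (v - (\<Sum>i\<in>I. cscale (\<beta> v (d i)) i)) w = 0" by (simp add: \<beta>_diff_left)
  qed
  then show ?thesis by simp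
qed

end

section \<open>Orthogonal complements\<close>

lemma subspace_perp: "cx.subspace (perp Q S)"
  by (auto simp: perp_def cx.subspace_def \<beta>_add_right \<beta>_scale_right)

lemma perp_antimono: "S \<subseteq> T \<Longrightarrow> perp Q T \<subseteq> perp Q S"
  by (auto simp: perp_def)

lemma basis_extension:
  assumes "cx.subspace S"
  obtains A I where "A \<subseteq> I" "cx.independent I" "cx.span I = UNIV" "cx.span A = S" "card A = cx.dim S"
proof -
  obtain A where A: "A \<subseteq> S" "cx.independent A" "S \<subseteq> cx.span A" "card A = cx.dim S"
    by (rule cx.basis_exists)
  obtain I where I: "A \<subseteq> I" "cx.independent I" "UNIV \<subseteq> cx.span I"
    by (rule cx.maximal_independent_subset_extend[OF subset_UNIV A(2)])
  show thesis
    by (rule that[OF I(1,2) _ _ A(4)]) (use I A cx.span_minimal[OF A(1) assms] in auto)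
qed

lemma perp_span: "perp Q (cx.span A) = perp Q A"
proof
  show "perp Q A \<subseteq> perp Q (cx.span A)"
  proof
    fix v assume v: "v \<in> perp Q A"
    have "\<beta> u v = 0" if "u \<in> cx.span A" for u
      using that by (induction rule: cx.span_induct_alt)
        (use v in \<open>auto simp: perp_def \<beta>_add_left \<beta>_scale_left\<close>)
    then show "v \<in> perp Q (cx.span A)" by (simp add: perp_def)
  qed
qed (simp add: perp_antimono cx.span_superset)

text \<open>If a basis \<open>A\<close> of \<open>S\<close> is extended to a basis \<open>I\<close>, the dual vectors of \<open>I - A\<close> form a basis of
  the orthogonal complement.\<close>

lemma dim_perp:
  assumes "cx.subspace S"
  shows "cx.dim (perp Q S) + cx.dim S = cx.dim (UNIV :: ('v \<times> 'v) set)"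
proof -
  obtain A I where I: "A \<subseteq> I" "cx.independent I" "cx.span I = UNIV" "cx.span A = S"
    "card A = cx.dim S"
    using basis_extension[OF assms] .
  obtain d where D: "dual_bases I d" using dual_basis_exists I by blast
  have S: "perp Q S = perp Q A" using perp_span I by metis
  have "cx.dim (perp Q S) = card (I - A)"
  proof (rule cx.dim_eq_card_coordinates[where E = d and \<phi> = \<beta>])
    show "finite (I - A)" using dual_finite[OF D] by simp
    show "cx.subspace (perp Q S)" by (rule subspace_perp)
    show "d p \<in> perp Q S" if "p \<in> I - A" for p
      using that I(1) unfolding S by (auto simp: perp_def dual_\<beta>[OF D])
    show "x = 0" if "x \<in> perp Q S" "\<forall>p\<in>I - A. \<beta> p x = 0" for x
      using that unfolding S by (intro zero_if_orthogonal_to_basis[OF D]) (auto simp: perp_def)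
  qed (auto simp: \<beta>_add_right \<beta>_scale_right dual_\<beta>[OF D])
  moreover have "card I = cx.dim (UNIV :: ('v \<times> 'v) set)"
    using I by (metis cx.dim_span_eq_card_independent cx.dim_span)
  moreover have "card A \<le> card I" using dual_finite[OF D] I(1) by (rule card_mono)
  ultimately show ?thesis
    using I(5) card_Diff_subset[OF finite_subset[OF I(1) dual_finite[OF D]] I(1)] by simp
qed

lemma perp_perp:
  assumes S: "cx.subspace S"
  shows "perp Q (perp Q S) = S"
proof -
  have "S \<subseteq> perp Q (perp Q S)" by (auto simp: perp_def \<beta>_eq_0_sym)
  moreover have "cx.dim (perp Q (perp Q S)) = cx.dim S"
    using dim_perp[OF S] dim_perp[OF subspace_perp[of S]] by simp
  ultimately show ?thesis
    using cxf.subspace_dim_equal[OF S subspace_perp[of "perp Q S"]] by simp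
qed

lemma perp_image_isometry:
  assumes g: "\<And>u v. \<beta> (g u) (g v) = \<beta> u v" and surj: "surj g"
  shows "perp Q (g ` S) = g ` perp Q S"
proof (intro equalityI subsetI)
  fix v assume v: "v \<in> perp Q (g ` S)"
  obtain w where w: "v = g w" by (rule surjE[OF surj, of v])
  then show "v \<in> g ` perp Q S" using v by (auto simp: perp_def g)
qed (auto simp: perp_def g)

section \<open>The isometry algebra in coordinates\<close>

lemma alg_linear: "X \<in> isometry_algebra Q \<Longrightarrow> Vector_Spaces.linear cscale cscale X"
  by (simp add: isometry_algebra_def)

lemma alg_skew: "X \<in> isometry_algebra Q \<Longrightarrow> \<beta> (X u) v = - \<beta> u (X v)"
  unfolding isometry_algebra_def eq_neg_iff_add_eq_0 by blast

lemma alg_add: "X \<in> isometry_algebra Q \<Longrightarrow> X (u + v) = X u + X v"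
  by (rule cxp.linear_add[OF alg_linear])

lemma alg_scale: "X \<in> isometry_algebra Q \<Longrightarrow> X (cscale c v) = cscale c (X v)"
  by (rule cxp.linear_scale[OF alg_linear])

lemma alg_sum: "X \<in> isometry_algebra Q \<Longrightarrow> X (sum g A) = (\<Sum>a\<in>A. X (g a))"
  by (rule cxp.linear_sum[OF alg_linear])

lemma alg_zero: "X \<in> isometry_algebra Q \<Longrightarrow> X 0 = 0"
  by (rule cxp.linear_0[OF alg_linear])

lemma algI:
  assumes "Vector_Spaces.linear cscale cscale X" and "\<And>u v. \<beta> (X u) v = - \<beta> u (X v)"
  shows "X \<in> isometry_algebra Q"
  using assms unfolding isometry_algebra_def eq_neg_iff_add_eq_0 by blast

lemma subspace_isometry_algebra: "endo.subspace (isometry_algebra Q)"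
  unfolding endo.subspace_def
proof (intro conjI ballI allI)
  show "0 \<in> isometry_algebra Q"
    by (intro algI clinearI) simp_all
next
  fix X Y assume X: "X \<in> isometry_algebra Q" and Y: "Y \<in> isometry_algebra Q"
  show "X + Y \<in> isometry_algebra Q"
    by (intro algI clinearI) (simp_all add: alg_add[OF X] alg_add[OF Y] alg_scale[OF X]
        alg_scale[OF Y] cx.scale_right_distrib \<beta>_add_left \<beta>_add_right alg_skew[OF X] alg_skew[OF Y])
next
  fix c X assume X: "X \<in> isometry_algebra Q"
  show "escale c X \<in> isometry_algebra Q"
    by (intro algI clinearI) (simp_all add: escale_def alg_add[OF X] alg_scale[OF X]
        cx.scale_right_distrib \<beta>_scale_left \<beta>_scale_right alg_skew[OF X] mult.commute)
qed

lemma component_iff: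
  assumes "r + s = 0"
  shows "X \<in> isometry_component n H Q r s \<longleftrightarrow>
    X \<in> isometry_algebra Q \<and> (\<forall>p. \<forall>v\<in>piece p. X v \<in> piece (p + r))"
proof -
  have *: "H (p + r) (q + s) = piece (p + r)" if "p + q = n" for p q
    by (rule H_eq_piece) (use assms that in simp)
  show ?thesis
  proof
    assume X: "X \<in> isometry_component n H Q r s"
    have "X v \<in> piece (p + r)" if "v \<in> piece p" for p v
    proof -
      have "X ` H p (n - p) \<subseteq> H (p + r) (n - p + s)"
        using X by (simp add: isometry_component_def)
      then show ?thesis using that *[of p "n - p"] by (auto simp: piece_def[of p])
    qed
    then show "X \<in> isometry_algebra Q \<and> (\<forall>p. \<forall>v\<in>piece p. X v \<in> piece (p + r))"
      using X by (simp add: isometry_component_def)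
  qed (auto simp: isometry_component_def H_eq_piece *)
qed

lemmas component_iff_lower = component_iff[of "-1" 1, simplified]

lemma block_iff:
  "X \<in> block n H Q k B \<longleftrightarrow>
     X \<in> isometry_component n H Q (-1) 1 \<and> (\<forall>v\<in>piece (n - k). X v \<in> B) \<and>
     (\<forall>p. p \<noteq> n - k \<longrightarrow> p \<noteq> k + 1 \<longrightarrow> (\<forall>v\<in>piece p. X v = 0))"
  (is "?L \<longleftrightarrow> ?R")
proof
  assume L: ?L
  have "X v = 0" if "p \<noteq> n - k" "p \<noteq> k + 1" "v \<in> piece p" for p v
  proof -
    have "X ` H p (n - p) \<subseteq> {0}" using L that(1,2) by (simp add: block_def)
    then show ?thesis using that(3) by (auto simp: piece_def)
  qed
  moreover have "H (n - k) k = piece (n - k)" by (simp add: H_eq_piece)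
  ultimately show ?R using L by (auto simp: block_def)
next
  assume R: ?R
  have "X ` H p q \<subseteq> {0}" if "p + q = n" "(p, q) \<noteq> (n - k, k)" "(p, q) \<noteq> (k + 1, n - k - 1)" for p q
  proof -
    have "p \<noteq> n - k" "p \<noteq> k + 1" using that by auto
    then show ?thesis using R that(1) by (auto simp: H_eq_piece)
  qed
  moreover have "H (n - k) k = piece (n - k)" by (simp add: H_eq_piece)
  ultimately show ?L using R by (auto simp: block_def)
qed

text \<open>The infinitesimal isometry with entry 1 at the position \<open>(i, j)\<close> and the entry at \<open>(j, i)\<close> that
  the symmetry forces. In odd weight a diagonal position receives both terms, whence the factor
  \<open>1 / 2\<close>.\<close>

definition elem :: "'v \<times> 'v \<Rightarrow> 'v \<times> 'v \<Rightarrow> 'v \<times> 'v \<Rightarrow> 'v \<times> 'v" where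
  "elem i j v = cscale (if i = j then 1 / 2 else 1)
     (cscale (\<beta> i v) j - cscale (sgn_n * \<beta> j v) i)"

lemma elem_in_algebra: "elem i j \<in> isometry_algebra Q"
proof -
  have "Vector_Spaces.linear cscale cscale (elem i j)"
    unfolding elem_def
    by (rule clinearI) (simp_all only: \<beta>_add_right \<beta>_scale_right distrib_left
        cx.scale_left_distrib cx.scale_right_distrib cx.scale_right_diff_distrib cx.scale_scale
        ac_simps add_diff_add)
  moreover have "\<beta> (elem i j u) v + \<beta> u (elem i j v) = 0" for u v
    using sgn_n_cases \<beta>_sym[of u i] \<beta>_sym[of u j]
    by (auto simp: elem_def \<beta>_diff_left \<beta>_diff_right \<beta>_scale_left \<beta>_scale_right)
  ultimately show ?thesis by (simp add: isometry_algebra_def)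
qed

text \<open>Membership only depends on the symmetrisation of \<open>P\<close>, since the entries at \<open>(i, j)\<close> and \<open>(j, i)\<close>
  agree up to sign.\<close>

definition supported ::
    "('v \<times> 'v) set \<Rightarrow> ('v \<times> 'v \<Rightarrow> 'v \<times> 'v) \<Rightarrow> (('v \<times> 'v) \<times> ('v \<times> 'v)) set \<Rightarrow>
     ('v \<times> 'v \<Rightarrow> 'v \<times> 'v) set" where
  "supported I d P = {X \<in> isometry_algebra Q.
     \<forall>i\<in>I. \<forall>j\<in>I. (i, j) \<notin> P \<longrightarrow> (j, i) \<notin> P \<longrightarrow> \<beta> (X (d i)) (d j) = 0}"

lemma coordinate_swap:
  "X \<in> isometry_algebra Q \<Longrightarrow> \<beta> (X u) v = 0 \<Longrightarrow> \<beta> (X v) u = 0"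
  by (simp add: alg_skew[of X v u] \<beta>_eq_0_sym[of v "X u"])

text \<open>The set \<open>P\<close> has to choose one position of each pair of transposed ones. For \<open>n\<close> even the matrices
  are antisymmetric, so diagonal positions carry no parameter.\<close>

lemma dim_supported:
  assumes D: "dual_bases I d" and P: "P \<subseteq> I \<times> I"
    and anti: "\<And>i j. (i, j) \<in> P \<Longrightarrow> (j, i) \<in> P \<Longrightarrow> i = j"
    and diag: "\<And>i. even n \<Longrightarrow> (i, i) \<notin> P"
  shows "endo.dim (supported I d P) = card P"
proof (rule endo.dim_eq_card_coordinates[where E = "\<lambda>(i, j). elem i j"
      and \<phi> = "\<lambda>(i, j) X. \<beta> (X (d i)) (d j)"])
  note \<beta>d = dual_\<beta>[OF D]
  have coord: "\<beta> (elem i j (d a)) (d b) = (if i = j then 1 / 2 else 1) *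
      ((if i = a \<and> j = b then 1 else 0) - (if j = a \<and> i = b then sgn_n else 0))"
    if "i \<in> I" "j \<in> I" "a \<in> I" "b \<in> I" for i j a b
    using that by (auto simp: elem_def \<beta>_diff_left \<beta>_scale_left \<beta>d)
  show "finite P" using P dual_finite[OF D] by (meson finite_SigmaI finite_subset)
  show "endo.subspace (supported I d P)"
    using subspace_isometry_algebra
    by (auto simp: supported_def endo.subspace_def escale_def \<beta>_add_left \<beta>_scale_left)
  show "(case p of (i, j) \<Rightarrow> elem i j) \<in> supported I d P" if "p \<in> P" for p
  proof -
    obtain i j where p: "p = (i, j)" by (cases p)
    then have ij: "(i, j) \<in> P" "i \<in> I" "j \<in> I" using that P by blast+
    have "\<beta> (elem i j (d a)) (d b) = 0"
      if "a \<in> I" "b \<in> I" "(a, b) \<notin> P" "(b, a) \<notin> P" for a b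
    proof -
      have "\<not> (i = a \<and> j = b)" "\<not> (j = a \<and> i = b)" using that ij by blast+
      then show ?thesis by (simp only: coord[OF ij(2,3) that(1,2)] if_False) simp
    qed
    then show ?thesis by (simp add: p supported_def elem_in_algebra)
  qed
  show "(case p of (i, j) \<Rightarrow> \<lambda>X. \<beta> (X (d i)) (d j)) (case q of (i, j) \<Rightarrow> elem i j)
      = (if p = q then 1 else 0)" if pq: "p \<in> P" "q \<in> P" for p q
  proof -
    obtain a b i j where ab: "p = (a, b)" "q = (i, j)" by (cases p, cases q) auto
    have I: "i \<in> I" "j \<in> I" "a \<in> I" "b \<in> I" using pq P ab by auto
    show ?thesis
    proof (cases "i = j")
      case True
      then have "sgn_n = - 1" using diag[of i] pq ab by (auto simp: sgn_n_def)
      then show ?thesis unfolding ab prod.case coord[OF I] using True by auto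
    next
      case False
      then have "\<not> (j = a \<and> i = b)" using anti[of i j] pq ab by auto
      then have "(if j = a \<and> i = b then sgn_n else 0) = 0" by (rule if_not_P)
      then show ?thesis
        unfolding ab prod.case coord[OF I] by (simp only: False if_False) auto
    qed
  qed
  show "X = 0" if X: "X \<in> supported I d P"
    and 0: "\<forall>p\<in>P. (case p of (i, j) \<Rightarrow> \<lambda>X. \<beta> (X (d i)) (d j)) X = 0" for X
  proof
    have XA: "X \<in> isometry_algebra Q" using X by (simp add: supported_def)
    have c: "\<beta> (X (d i)) (d j) = 0" if ij: "i \<in> I" "j \<in> I" for i j
    proof (cases "(i, j) \<in> P \<or> (j, i) \<in> P")
      case True
      then show ?thesis using 0 coordinate_swap[OF XA, of "d j" "d i"] by auto
    next
      case False
      then show ?thesis using X ij by (simp add: supported_def)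
    qed
    have Xd: "X (d i) = 0" if "i \<in> I" for i
      by (subst expand_in_basis[OF D]) (simp add: c that)
    fix v
    show "X v = 0 v"
      by (subst expand_in_dual[OF D, of v]) (simp add: alg_sum[OF XA] alg_scale[OF XA] Xd)
  qed
qed (auto simp: escale_def \<beta>_add_left \<beta>_scale_left)

section \<open>Adapted bases\<close>

definition adapted :: "('v \<times> 'v) set \<Rightarrow> bool" where
  "adapted I \<longleftrightarrow> cx.independent I \<and> cx.span I = UNIV \<and> I \<subseteq> (\<Union>p. piece p) \<and>
     (\<forall>p. cx.span (I \<inter> piece p) = piece p)"

lemma pieces_disjoint: "v \<in> piece p \<Longrightarrow> v \<in> piece q \<Longrightarrow> v \<noteq> 0 \<Longrightarrow> p = q"
  using proj_piece[of v p p] proj_piece[of v q p] by (auto split: if_splits)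

text \<open>Choose a basis in each Hodge space, in degree \<open>r\<close> one that extends a basis of \<open>B\<close>. The
  projections show that the union stays independent.\<close>

lemma adapted_basis_exists:
  assumes B: "cx.subspace B" "B \<subseteq> piece r"
  shows "\<exists>I. adapted I \<and> cx.span (I \<inter> B) = B"
proof -
  obtain A0 where A0: "A0 \<subseteq> B" "cx.independent A0" "B \<subseteq> cx.span A0" "card A0 = cx.dim B"
    by (rule cx.basis_exists)
  have "\<exists>A. A \<subseteq> piece p \<and> cx.independent A \<and> piece p \<subseteq> cx.span A \<and> (p = r \<longrightarrow> A0 \<subseteq> A)" for p
  proof (cases "p = r")
    case True
    have "A0 \<subseteq> piece r" using A0(1) B(2) by blast
    then obtain A where "A0 \<subseteq> A" "A \<subseteq> piece r" "cx.independent A" "piece r \<subseteq> cx.span A"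
      using A0(2) by (rule cx.maximal_independent_subset_extend)
    then show ?thesis using True by auto
  next
    case False
    obtain A where "A \<subseteq> piece p" "cx.independent A" "piece p \<subseteq> cx.span A" "card A = cx.dim (piece p)"
      by (rule cx.basis_exists)
    then show ?thesis using False by auto
  qed
  then obtain A where A: "\<And>p. A p \<subseteq> piece p" "\<And>p. cx.independent (A p)"
      "\<And>p. piece p \<subseteq> cx.span (A p)" "A0 \<subseteq> A r"
    by metis
  have span_A: "cx.span (A p) = piece p" for p
    using A(3)[of p] cx.span_minimal[OF A(1) subspace_piece] by blast
  have nz: "x \<noteq> 0" if "x \<in> A p" for x p
    using that A(2)[of p] cx.dependent_zero by auto
  define I where "I = (\<Union>p. A p)"
  have I_piece: "I \<inter> piece p = A p" for p
  proof (intro equalityI subsetI)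
    fix x assume "x \<in> I \<inter> piece p"
    then obtain q where q: "x \<in> A q" "x \<in> piece p" by (auto simp: I_def)
    then have "q = p" using pieces_disjoint[of x q p] A(1)[of q] nz by blast
    then show "x \<in> A p" using q by simp
  qed (use A(1) in \<open>auto simp: I_def\<close>)
  have "A p = {}" if "p \<notin> {0..n}" for p
    using A(1)[of p] nz piece_outside[OF that] by auto
  then have "I \<subseteq> (\<Union>p\<in>{0..n}. A p)" unfolding I_def by blast
  then have fin: "finite I"
    by (rule finite_subset) (intro finite_UN_I finite_atLeastAtMost_int cxf.finiteI_independent A(2))
  have "cx.independent I"
  proof (rule cx.independent_if_scalars_zero[OF fin])
    fix c x assume eq: "(\<Sum>x\<in>I. cscale (c x) x) = 0" and x: "x \<in> I"
    then obtain p where p: "x \<in> A p" by (auto simp: I_def)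
    have "(\<Sum>y\<in>A p. cscale (c y) y) = (\<Sum>y\<in>I. if y \<in> A p then cscale (c y) y else 0)"
      unfolding I_piece[symmetric] using fin by (simp add: sum.inter_restrict)
    also have "\<dots> = (\<Sum>y\<in>I. proj p (cscale (c y) y))"
    proof (rule sum.cong)
      fix y assume "y \<in> I"
      then obtain q where q: "y \<in> A q" by (auto simp: I_def)
      have "y \<in> A p \<longleftrightarrow> p = q"
        using q nz[OF q] A(1)[of p] A(1)[of q] pieces_disjoint[of y p q] by blast
      then show "(if y \<in> A p then cscale (c y) y else 0) = proj p (cscale (c y) y)"
        using proj_piece[OF subsetD[OF A(1) q], of p] by (simp add: proj_scale)
    qed simp
    also have "\<dots> = 0" using eq by (simp add: proj_sum[symmetric])
    finally show "c x = 0"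
      using cx.independentD[OF A(2) _ order_refl _ p] fin I_piece by (metis finite_Int)
  qed
  moreover have "cx.span I = UNIV"
  proof (rule UNIV_eq_I[symmetric])
    fix v
    have "proj p v \<in> cx.span I" for p
      using proj_mem[of p v] span_A[of p] cx.span_mono[of "A p" I] by (auto simp: I_def)
    then show "v \<in> cx.span I"
      by (subst sum_proj[of v, symmetric]) (intro cx.span_sum)
  qed
  moreover have "cx.span (I \<inter> B) = B"
  proof
    show "cx.span (I \<inter> B) \<subseteq> B" by (rule cx.span_minimal[OF _ B(1)]) simp
    have "A0 \<subseteq> I \<inter> B" using A(4) A0(1) by (auto simp: I_def)
    then show "B \<subseteq> cx.span (I \<inter> B)" using A0(3) cx.span_mono by blast
  qed
  moreover have "I \<subseteq> (\<Union>p. piece p)" using A(1) by (auto simp: I_def)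
  ultimately show ?thesis using I_piece span_A by (auto simp: adapted_def)
qed

context
  fixes I d assumes A: "adapted I" and D: "dual_bases I d"
begin

lemma adapted_obtain:
  assumes "i \<in> I"
  obtains p where "i \<in> piece p" "0 \<le> p" "p \<le> n"
proof -
  obtain p where p: "i \<in> piece p" using A assms by (auto simp: adapted_def)
  have "i \<noteq> 0" using A assms cx.dependent_zero by (auto simp: adapted_def)
  then have "p \<in> {0..n}" using p piece_outside[of p] by auto
  then show thesis using that p by auto
qed

lemma adapted_nonzero: "i \<in> I \<Longrightarrow> i \<noteq> 0"
  using A cx.dependent_zero[of I] unfolding adapted_def by blast

lemma adapted_unique: "i \<in> I \<Longrightarrow> i \<in> piece p \<Longrightarrow> i \<in> piece q \<Longrightarrow> p = q"
  by (rule pieces_disjoint[OF _ _ adapted_nonzero])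

lemma card_adapted:
  assumes "cx.span (I \<inter> B) = B"
  shows "card (I \<inter> B) = cx.dim B"
proof -
  have "cx.independent (I \<inter> B)"
    using A cx.independent_mono[of I "I \<inter> B"] unfolding adapted_def by blast
  then show ?thesis using cx.dim_eq_card_independent cx.dim_span assms by metis
qed

lemma card_adapted_piece: "card (I \<inter> piece p) = cx.dim (piece p)"
  using A by (intro card_adapted) (simp add: adapted_def)

lemma \<beta>_span_dual:
  assumes "v \<in> cx.span J" "J \<subseteq> I" "j \<in> I" "j \<notin> J"
  shows "\<beta> v (d j) = 0"
  using assms(1)
proof (induction rule: cx.span_induct_alt)
  case (step c x y)
  then have "\<beta> x (d j) = 0" using assms dual_\<beta>[OF D, of x j] by auto
  then show ?case using step by (simp add: \<beta>_add_left \<beta>_scale_left)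
qed simp

text \<open>The dual vector of \<open>i\<close> is orthogonal to all basis vectors outside \<open>piece p\<close>, hence has only the
  component that pairs with \<open>piece p\<close>.\<close>

lemma dual_mem:
  assumes i: "i \<in> I" "i \<in> piece p"
  shows "d i \<in> piece (n - p)"
  unfolding mem_piece_iff
proof (intro allI impI, rule proj_eq_0I)
  fix r w assume r: "r \<noteq> n - p" and "w \<in> piece (n - r)"
  then have "w \<in> cx.span (I \<inter> piece (n - r))" using A by (simp add: adapted_def)
  moreover have "i \<notin> I \<inter> piece (n - r)" using adapted_unique[OF i, of "n - r"] r by auto
  ultimately have "\<beta> w (d i) = 0" using \<beta>_span_dual i by blast
  then show "\<beta> (d i) w = 0" by (simp add: \<beta>_eq_0_sym)
qed

text \<open>The dual vectors of the basis of one Hodge space form a basis of the complementary one.\<close>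

lemma dim_piece_sym: "cx.dim (piece (n - p)) = cx.dim (piece p)"
proof -
  have "cx.dim (piece (n - p)) = card (I \<inter> piece p)"
  proof (rule cx.dim_eq_card_coordinates[where E = d and \<phi> = \<beta>])
    fix v assume v: "v \<in> piece (n - p)" "\<forall>i\<in>I \<inter> piece p. \<beta> i v = 0"
    show "v = 0"
    proof (rule zero_if_orthogonal_to_basis[OF D])
      fix i assume i: "i \<in> I"
      then obtain q where "i \<in> piece q" by (rule adapted_obtain)
      then show "\<beta> i v = 0" using v i piece_orthogonal[of i q v "n - p"] by (cases "p = q") auto
    qed
  qed (auto simp: dual_finite[OF D] subspace_piece dual_mem \<beta>_add_right \<beta>_scale_right dual_\<beta>[OF D])
  then show ?thesis by (simp add: card_adapted_piece)
qed

text \<open>The entries in row \<open>i\<close> are the coefficients of \<open>X (d i)\<close> in the basis \<open>I\<close>. Conditions on the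
  images of vectors of one Hodge space are therefore vanishing conditions on entries.\<close>

lemma image_in_subspace:
  assumes X: "X \<in> isometry_algebra Q" and W: "cx.subspace W" and v: "v \<in> piece p"
    and 0: "\<And>i j. i \<in> I \<Longrightarrow> i \<in> piece (n - p) \<Longrightarrow> j \<in> I \<Longrightarrow> j \<notin> W \<Longrightarrow> \<beta> (X (d i)) (d j) = 0"
  shows "X v \<in> W"
proof -
  have "cscale (\<beta> i v) (X (d i)) \<in> W" if i: "i \<in> I" for i
  proof (cases "i \<in> piece (n - p)")
    case True
    have "cscale (\<beta> (X (d i)) (d j)) j \<in> W" if "j \<in> I" for j
      using 0[OF i True that] W by (cases "j \<in> W") (auto simp: cx.subspace_scale cx.subspace_0)
    then have "X (d i) \<in> W"
      by (subst expand_in_basis[OF D]) (rule cx.subspace_sum[OF W])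
    then show ?thesis by (rule cx.subspace_scale[OF W])
  next
    case False
    obtain q where "i \<in> piece q" using i by (rule adapted_obtain)
    with False have "\<beta> i v = 0" by (intro piece_orthogonal[OF _ v, of i q]) auto
    then show ?thesis using cx.subspace_0[OF W] by simp
  qed
  then show ?thesis
    by (subst expand_in_dual[OF D, of v])
      (simp add: alg_sum[OF X] alg_scale[OF X] cx.subspace_sum[OF W])
qed

lemma lower_coordinate_zero:
  assumes X: "X \<in> isometry_component n H Q (-1) 1"
    and "i \<in> I" "i \<in> piece p" "j \<in> I" "j \<in> piece q" "p + q \<noteq> n - 1"
  shows "\<beta> (X (d i)) (d j) = 0"
proof (rule piece_orthogonal)
  show "X (d i) \<in> piece (n - p - 1)"
    using X dual_mem[OF assms(2,3)] by (auto simp: component_iff_lower)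
  show "d j \<in> piece (n - q)" by (rule dual_mem[OF assms(4,5)])
qed (use assms(6) in linarith)

lemma lower_component_eq_supported:
  assumes P: "\<And>i j. i \<in> I \<Longrightarrow> j \<in> I \<Longrightarrow>
    (i, j) \<in> P \<or> (j, i) \<in> P \<longleftrightarrow> (\<exists>p. i \<in> piece p \<and> j \<in> piece (n - 1 - p))"
  shows "isometry_component n H Q (-1) 1 = supported I d P"
proof (intro equalityI subsetI)
  fix X assume X: "X \<in> isometry_component n H Q (-1) 1"
  have "\<beta> (X (d i)) (d j) = 0" if ij: "i \<in> I" "j \<in> I" "\<not> ((i, j) \<in> P \<or> (j, i) \<in> P)" for i j
  proof -
    obtain p q where pq: "i \<in> piece p" "j \<in> piece q" using ij adapted_obtain by metis
    then have "p + q \<noteq> n - 1" using ij P[of i j] by (metis add_diff_cancel_left')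
    then show ?thesis using lower_coordinate_zero[OF X] ij pq by blast
  qed
  then show "X \<in> supported I d P" using X by (auto simp: supported_def component_iff_lower)
next
  fix X assume X: "X \<in> supported I d P"
  then have XA: "X \<in> isometry_algebra Q" by (simp add: supported_def)
  have "X v \<in> piece (p - 1)" if v: "v \<in> piece p" for p v
  proof (rule image_in_subspace[OF XA subspace_piece v])
    fix i j assume ij: "i \<in> I" "i \<in> piece (n - p)" "j \<in> I" "j \<notin> piece (p - 1)"
    have "\<not> (\<exists>q. i \<in> piece q \<and> j \<in> piece (n - 1 - q))"
    proof
      assume "\<exists>q. i \<in> piece q \<and> j \<in> piece (n - 1 - q)"
      then obtain q where q: "i \<in> piece q" "j \<in> piece (n - 1 - q)" by blast
      then have "q = n - p" using adapted_unique[OF ij(1)] ij(2) by blast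
      then show False using q ij(4) by simp
    qed
    then show "\<beta> (X (d i)) (d j) = 0" using X ij P[of i j] by (auto simp: supported_def)
  qed
  then show "X \<in> isometry_component n H Q (-1) 1" using XA by (simp add: component_iff_lower)
qed

text \<open>The positions \<open>(i, j)\<close> describe the component on \<open>piece (n - k)\<close>, whose values lie in \<open>B\<close>; the
  transposed positions describe its adjoint. If \<open>n = 2 * k + 1\<close>, both lie in the same square and
  would enlarge \<open>B\<close>, unless \<open>B\<close> is all of \<open>piece k\<close>.\<close>

lemma block_eq_supported:
  assumes B: "cx.subspace B" "B \<subseteq> piece (n - k - 1)" "cx.span (I \<inter> B) = B"
    and k: "2 * k + 1 = n \<longrightarrow> B = piece k"
  shows "block n H Q k B = supported I d ((I \<inter> piece k) \<times> (I \<inter> B))"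
proof (intro equalityI subsetI)
  fix X assume "X \<in> block n H Q k B"
  then have X: "X \<in> isometry_component n H Q (-1) 1" "\<And>v. v \<in> piece (n - k) \<Longrightarrow> X v \<in> B"
      "\<And>p v. p \<noteq> n - k \<Longrightarrow> p \<noteq> k + 1 \<Longrightarrow> v \<in> piece p \<Longrightarrow> X v = 0"
    by (auto simp: block_iff)
  have XA: "X \<in> isometry_algebra Q" using X(1) by (simp add: component_iff_lower)
  have toB: "\<beta> (X (d i)) (d j) = 0" if ij: "i \<in> I" "i \<in> piece k" "j \<in> I" "j \<notin> B" for i j
  proof -
    have "X (d i) \<in> cx.span (I \<inter> B)" using X(2)[OF dual_mem[OF ij(1,2)]] B(3) by simp
    then show ?thesis using ij by (intro \<beta>_span_dual[of _ "I \<inter> B"]) auto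
  qed
  have "\<beta> (X (d i)) (d j) = 0"
    if ij: "i \<in> I" "j \<in> I" "(i, j) \<notin> (I \<inter> piece k) \<times> (I \<inter> B)" "(j, i) \<notin> (I \<inter> piece k) \<times> (I \<inter> B)"
    for i j
  proof -
    obtain p q where pq: "i \<in> piece p" "j \<in> piece q" using ij adapted_obtain by metis
    consider "p + q \<noteq> n - 1" | "p = k" | "p + q = n - 1" "q = k"
      | "p \<noteq> k" "p \<noteq> n - 1 - k" by linarith
    then show ?thesis
    proof cases
      case 1
      then show ?thesis using lower_coordinate_zero[OF X(1)] ij pq by blast
    next
      case 2
      then show ?thesis using toB ij pq by auto
    next
      case 3
      then show ?thesis using toB[of j i] coordinate_swap[OF XA] ij pq by auto
    next
      case 4
      have "X (d i) = 0"
        by (rule X(3)[OF _ _ dual_mem[OF ij(1) pq(1)]]) (use 4 in auto)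
      then show ?thesis by simp
    qed
  qed
  then show "X \<in> supported I d ((I \<inter> piece k) \<times> (I \<inter> B))"
    using XA by (simp add: supported_def)
next
  fix X assume X: "X \<in> supported I d ((I \<inter> piece k) \<times> (I \<inter> B))"
  then have XA: "X \<in> isometry_algebra Q" by (simp add: supported_def)
  have zero: "\<beta> (X (d i)) (d j) = 0"
    if "i \<in> I" "j \<in> I" "\<not> (i \<in> piece k \<and> j \<in> B)" "\<not> (j \<in> piece k \<and> i \<in> B)" for i j
    using X that by (simp add: supported_def)
  have uniq: "p = q" if "i \<in> I" "i \<in> piece p" "i \<in> piece q" for i p q
    using adapted_unique that by blast
  have inB: "i \<in> piece (n - k - 1)" if "i \<in> B" for i using B(2) that by blast
  have "X v \<in> piece (p - 1)" if v: "v \<in> piece p" for p v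
  proof (rule image_in_subspace[OF XA subspace_piece v])
    fix i j assume ij: "i \<in> I" "i \<in> piece (n - p)" "j \<in> I" "j \<notin> piece (p - 1)"
    show "\<beta> (X (d i)) (d j) = 0"
    proof (rule zero[OF ij(1,3)])
      show "\<not> (i \<in> piece k \<and> j \<in> B)"
      proof
        assume *: "i \<in> piece k \<and> j \<in> B"
        then have "n - p = k" using uniq[OF ij(1,2)] by blast
        then have "n - k - 1 = p - 1" by simp
        then show False using * inB[of j] ij(4) by simp
      qed
      show "\<not> (j \<in> piece k \<and> i \<in> B)"
      proof
        assume *: "j \<in> piece k \<and> i \<in> B"
        then have "n - p = n - k - 1" using uniq[OF ij(1,2)] inB by blast
        then have "k = p - 1" by simp
        then show False using * ij(4) by simp
      qed
    qed
  qed
  moreover have "X v \<in> B" if v: "v \<in> piece (n - k)" for v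
  proof (rule image_in_subspace[OF XA B(1) v])
    fix i j assume ij: "i \<in> I" "i \<in> piece (n - (n - k))" "j \<in> I" "j \<notin> B"
    show "\<beta> (X (d i)) (d j) = 0"
    proof (rule zero[OF ij(1,3)])
      show "\<not> (j \<in> piece k \<and> i \<in> B)"
      proof
        assume *: "j \<in> piece k \<and> i \<in> B"
        then have "n - (n - k) = n - k - 1" using uniq[OF ij(1,2)] inB by blast
        then show False using * k ij(4) by auto
      qed
    qed (use ij in simp)
  qed
  moreover have "X v = 0" if p: "p \<noteq> n - k" "p \<noteq> k + 1" and v: "v \<in> piece p" for p v
  proof -
    have "X v \<in> {0}"
    proof (rule image_in_subspace[OF XA cx.subspace_single_0 v])
      fix i j assume ij: "i \<in> I" "i \<in> piece (n - p)" "j \<in> I"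
      show "\<beta> (X (d i)) (d j) = 0"
      proof (rule zero[OF ij(1,3)])
        show "\<not> (i \<in> piece k \<and> j \<in> B)" using uniq[OF ij(1,2), of k] p by auto
        show "\<not> (j \<in> piece k \<and> i \<in> B)" using uniq[OF ij(1,2), of "n - k - 1"] inB[of i] p by auto
      qed
    qed
    then show ?thesis by simp
  qed
  ultimately show "X \<in> block n H Q k B"
    using XA by (simp add: block_iff component_iff_lower)
qed

end

section \<open>Dimensions\<close>

lemma adapted_dual_bases_exist:
  assumes "cx.subspace B" "B \<subseteq> piece r"
  obtains I d where "adapted I" "dual_bases I d" "cx.span (I \<inter> B) = B"
  using adapted_basis_exists[OF assms] dual_basis_exists unfolding adapted_def by blast

abbreviation hn :: "int \<Rightarrow> nat" where "hn \<equiv> hodge_number n H"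

lemma dim_piece: "cx.dim (piece p) = hn p"
proof -
  obtain I d where "adapted I" "dual_bases I d"
    using adapted_dual_bases_exist[OF cx.subspace_single_0, of 0] cx.subspace_0[OF subspace_piece]
    by (metis empty_subsetI insert_subset)
  from dim_piece_sym[OF this, of p] show ?thesis
    by (simp add: hodge_number_def H_eq_piece)
qed

lemma dim_block:
  assumes B: "cx.subspace B" "B \<subseteq> piece (n - k - 1)" and k: "2 * k + 1 \<noteq> n"
  shows "endo.dim (block n H Q k B) = hn k * cx.dim B"
proof -
  obtain I d where A: "adapted I" and D: "dual_bases I d" and S: "cx.span (I \<inter> B) = B"
    using adapted_dual_bases_exist[OF B] .
  let ?P = "(I \<inter> piece k) \<times> (I \<inter> B)"
  have disj: False if "i \<in> I" "i \<in> piece k" "i \<in> B" for i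
    using adapted_unique[OF A D that(1,2), of "n - k - 1"] that(3) B(2) k by auto
  have "endo.dim (block n H Q k B) = endo.dim (supported I d ?P)"
    by (subst block_eq_supported[OF A D B S]) (use k in auto)
  also have "\<dots> = card ?P"
    by (rule dim_supported[OF D]) (auto dest: disj)
  finally show ?thesis
    by (simp add: card_cartesian_product card_adapted_piece[OF A D] card_adapted[OF A D S] dim_piece)
qed

lemma dim_symmetric_block:
  assumes k: "n = 2 * k + 1"
  shows "2 * endo.dim (block n H Q k (piece k)) = hn k * (hn k + 1)"
proof -
  obtain I d where A: "adapted I" and D: "dual_bases I d" and S: "cx.span (I \<inter> piece k) = piece k"
    using adapted_dual_bases_exist[OF subspace_piece order_refl] .
  let ?J = "I \<inter> piece k"
  have fin: "finite ?J" using dual_finite[OF D] by simp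
  obtain h :: "'v \<times> 'v \<Rightarrow> nat" where h: "inj_on h ?J" using finite_imp_inj_to_nat_seg[OF fin] by metis
  let ?T = "{(i, j) \<in> ?J \<times> ?J. h i \<le> h j}"
  have "block n H Q k (piece k) = supported I d (?J \<times> ?J)"
    by (rule block_eq_supported[OF A D subspace_piece _ S]) (use k in auto)
  also have "\<dots> = supported I d ?T"
    by (auto simp: supported_def)
  finally have "endo.dim (block n H Q k (piece k)) = card ?T"
    using dim_supported[OF D, of ?T] h k by (auto dest: inj_onD)
  then show ?thesis
    using card_triangle[OF fin h] by (simp add: card_adapted_piece[OF A D] dim_piece)
qed

text \<open>The positions of the blocks \<open>Hom (piece (n - p), piece (n - p - 1))\<close> for \<open>0 \<le> p < m\<close>.\<close>

definition lower_pairs :: "('v \<times> 'v) set \<Rightarrow> int \<Rightarrow> (('v \<times> 'v) \<times> ('v \<times> 'v)) set" where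
  "lower_pairs I m = (\<Union>p\<in>{0..m - 1}. (I \<inter> piece p) \<times> (I \<inter> piece (n - 1 - p)))"

lemma lower_pairs_iff:
  "(i, j) \<in> lower_pairs I m \<longleftrightarrow>
    i \<in> I \<and> j \<in> I \<and> (\<exists>p. 0 \<le> p \<and> p < m \<and> i \<in> piece p \<and> j \<in> piece (n - 1 - p))"
  unfolding lower_pairs_def by auto

lemma lower_pairs_pieces:
  assumes "(i, j) \<in> lower_pairs I m \<or> (j, i) \<in> lower_pairs I m"
  shows "\<exists>p. i \<in> piece p \<and> j \<in> piece (n - 1 - p)"
  using assms
proof
  assume "(j, i) \<in> lower_pairs I m"
  then obtain p where "j \<in> piece p" "i \<in> piece (n - 1 - p)" by (auto simp: lower_pairs_iff)
  then show ?thesis by (intro exI[of _ "n - 1 - p"]) simp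
qed (auto simp: lower_pairs_iff)

context
  fixes I d and m :: int assumes A: "adapted I" and D: "dual_bases I d"
begin

lemma card_lower_pairs: "card (lower_pairs I m) = (\<Sum>p\<in>{0..m - 1}. hn p * hn (p + 1))"
proof -
  have hn: "hn (p + 1) = cx.dim (piece (n - 1 - p))" for p
    by (simp add: hodge_number_def H_eq_piece algebra_simps)
  have fin: "finite (I \<inter> piece p)" for p using dual_finite[OF D] by simp
  have "card (lower_pairs I m)
      = (\<Sum>p\<in>{0..m - 1}. card ((I \<inter> piece p) \<times> (I \<inter> piece (n - 1 - p))))"
    unfolding lower_pairs_def
  proof (rule card_UN_disjoint)
    show "\<forall>p\<in>{0..m - 1}. \<forall>q\<in>{0..m - 1}. p \<noteq> q \<longrightarrow>
        ((I \<inter> piece p) \<times> (I \<inter> piece (n - 1 - p))) \<inter> ((I \<inter> piece q) \<times> (I \<inter> piece (n - 1 - q))) = {}"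
      using adapted_unique[OF A D] by blast
  qed (use fin in auto)
  then show ?thesis
    by (simp only: card_cartesian_product card_adapted_piece[OF A D] dim_piece hn)
qed

lemma lower_pairs_asym:
  assumes "2 * m \<le> n" "(i, j) \<in> lower_pairs I m"
  shows "(j, i) \<notin> lower_pairs I m"
proof
  assume "(j, i) \<in> lower_pairs I m"
  then obtain p q where "i \<in> I" "i \<in> piece p" "i \<in> piece (n - 1 - q)" "p < m" "q < m"
    using assms(2) by (auto simp: lower_pairs_iff)
  then show False using adapted_unique[OF A D, of i p "n - 1 - q"] assms(1) by auto
qed

text \<open>Of the two degrees \<open>p\<close> and \<open>n - 1 - p\<close> one is below \<open>m\<close>, except in the middle of odd weight.\<close>

lemma lower_pairs_complete:
  assumes ij: "i \<in> I" "j \<in> I" and p: "i \<in> piece p" "j \<in> piece (n - 1 - p)" and m: "n \<le> 2 * m + 1"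
  shows "(i, j) \<in> lower_pairs I m \<or> (j, i) \<in> lower_pairs I m \<or> p = m \<and> n = 2 * m + 1"
proof -
  note uniq = adapted_unique[OF A D]
  obtain p' where "i \<in> piece p'" "0 \<le> p'" using adapted_obtain[OF A D ij(1)] .
  then have "0 \<le> p" using uniq[OF ij(1) p(1)] by blast
  obtain q' where "j \<in> piece q'" "0 \<le> q'" using adapted_obtain[OF A D ij(2)] .
  then have q: "0 \<le> n - 1 - p" using uniq[OF ij(2) p(2)] by blast
  have "i \<in> piece (n - 1 - (n - 1 - p))" using p by simp
  then have "n - 1 - p < m \<Longrightarrow> (j, i) \<in> lower_pairs I m"
    using ij p q unfolding lower_pairs_iff by blast
  moreover have "p < m \<Longrightarrow> (i, j) \<in> lower_pairs I m"
    using ij p \<open>0 \<le> p\<close> unfolding lower_pairs_iff by blast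
  moreover have "p < m \<or> n - 1 - p < m \<or> p = m \<and> n = 2 * m + 1" using m by linarith
  ultimately show ?thesis by blast
qed

end

lemma dim_lower_component_even:
  assumes n: "n = 2 * m"
  shows "endo.dim (isometry_component n H Q (-1) 1) = (\<Sum>k\<in>{0..m - 1}. hn k * hn (k + 1))"
proof -
  obtain I d where A: "adapted I" and D: "dual_bases I d"
    using adapted_dual_bases_exist[OF subspace_piece order_refl] .
  have asym: "(i, j) \<in> lower_pairs I m \<Longrightarrow> (j, i) \<notin> lower_pairs I m" for i j
    using lower_pairs_asym[OF A D] n by simp
  have "isometry_component n H Q (-1) 1 = supported I d (lower_pairs I m)"
  proof (rule lower_component_eq_supported[OF A D])
    fix i j assume ij: "i \<in> I" "j \<in> I"
    show "(i, j) \<in> lower_pairs I m \<or> (j, i) \<in> lower_pairs I m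
        \<longleftrightarrow> (\<exists>p. i \<in> piece p \<and> j \<in> piece (n - 1 - p))"
    proof
      assume "\<exists>p. i \<in> piece p \<and> j \<in> piece (n - 1 - p)"
      then obtain p where p: "i \<in> piece p" "j \<in> piece (n - 1 - p)" by blast
      show "(i, j) \<in> lower_pairs I m \<or> (j, i) \<in> lower_pairs I m"
        using lower_pairs_complete[OF A D ij p, of m] n by auto
    qed (rule lower_pairs_pieces)
  qed
  also have "endo.dim \<dots> = card (lower_pairs I m)"
  proof (rule dim_supported[OF D])
    show "lower_pairs I m \<subseteq> I \<times> I" unfolding lower_pairs_def by blast
  qed (use asym in blast)+
  finally show ?thesis by (simp add: card_lower_pairs[OF A D])
qed

text \<open>Besides the ordinary blocks there is the square of positions with both indices in \<open>piece m\<close>,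
  of which a triangle \<open>T\<close> including the diagonal is counted.\<close>

lemma dim_lower_component_odd:
  assumes n: "n = 2 * m + 1"
  shows "2 * endo.dim (isometry_component n H Q (-1) 1)
    = 2 * (\<Sum>k\<in>{0..m - 1}. hn k * hn (k + 1)) + hn m * (hn m + 1)"
proof -
  obtain I d where A: "adapted I" and D: "dual_bases I d"
    using adapted_dual_bases_exist[OF subspace_piece order_refl] .
  define J where "J = I \<inter> piece m"
  have fin: "finite J" using dual_finite[OF D] by (simp add: J_def)
  obtain h :: "'v \<times> 'v \<Rightarrow> nat" where h: "inj_on h J" using finite_imp_inj_to_nat_seg[OF fin] by metis
  define T where "T = {(i, j) \<in> J \<times> J. h i \<le> h j}"
  have T_iff: "(i, j) \<in> T \<longleftrightarrow> i \<in> J \<and> j \<in> J \<and> h i \<le> h j" for i j by (simp add: T_def)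
  have asym: "(i, j) \<in> lower_pairs I m \<Longrightarrow> (j, i) \<notin> lower_pairs I m" for i j
    using lower_pairs_asym[OF A D] n by simp
  have off_J: "i \<notin> J \<and> j \<notin> J" if "(i, j) \<in> lower_pairs I m" for i j
  proof -
    from that obtain p where p: "i \<in> I" "j \<in> I" "p < m" "i \<in> piece p" "j \<in> piece (n - 1 - p)"
      unfolding lower_pairs_iff by blast
    then show ?thesis
      using adapted_unique[OF A D, of i p m] adapted_unique[OF A D, of j "n - 1 - p" m] n
      by (auto simp: J_def)
  qed
  have "isometry_component n H Q (-1) 1 = supported I d (lower_pairs I m \<union> T)"
  proof (rule lower_component_eq_supported[OF A D])
    fix i j assume ij: "i \<in> I" "j \<in> I"
    show "(i, j) \<in> lower_pairs I m \<union> T \<or> (j, i) \<in> lower_pairs I m \<union> T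
        \<longleftrightarrow> (\<exists>p. i \<in> piece p \<and> j \<in> piece (n - 1 - p))" (is "?L \<longleftrightarrow> ?R")
    proof
      assume ?L
      then consider "(i, j) \<in> lower_pairs I m \<or> (j, i) \<in> lower_pairs I m" | "i \<in> J" "j \<in> J"
        by (auto simp: T_iff)
      then show ?R
      proof cases
        case 1
        then show ?R by (rule lower_pairs_pieces)
      next
        case 2
        then show ?R using n by (intro exI[of _ m]) (simp add: J_def)
      qed
    next
      assume ?R
      then obtain p where p: "i \<in> piece p" "j \<in> piece (n - 1 - p)" by blast
      have "i \<in> J \<and> j \<in> J" if "p = m" using that p ij n by (simp add: J_def)
      then have "p = m \<Longrightarrow> (i, j) \<in> T \<or> (j, i) \<in> T" unfolding T_iff by linarith
      then show ?L using lower_pairs_complete[OF A D ij p, of m] n by blast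
    qed
  qed
  also have "endo.dim \<dots> = card (lower_pairs I m \<union> T)"
  proof (rule dim_supported[OF D])
    show "lower_pairs I m \<union> T \<subseteq> I \<times> I" unfolding lower_pairs_def T_def J_def by blast
    fix i j assume *: "(i, j) \<in> lower_pairs I m \<union> T" "(j, i) \<in> lower_pairs I m \<union> T"
    then have "(i, j) \<in> T" "(j, i) \<in> T"
      using asym[of i j] off_J[of i j] off_J[of j i] unfolding Un_iff T_iff by blast+
    then show "i = j" using inj_onD[OF h, of i j] by (simp add: T_iff)
  qed (use n in simp)
  also have "\<dots> = card (lower_pairs I m) + card T"
  proof (rule card_Un_disjoint)
    have "finite (I \<times> I)" using dual_finite[OF D] by simp
    moreover have "lower_pairs I m \<subseteq> I \<times> I" "T \<subseteq> I \<times> I"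
      unfolding lower_pairs_def T_def J_def by blast+
    ultimately show "finite (lower_pairs I m)" "finite T" using finite_subset by blast+
    show "lower_pairs I m \<inter> T = {}"
    proof (rule equals0I)
      fix x assume x: "x \<in> lower_pairs I m \<inter> T"
      obtain i j where "x = (i, j)" by (cases x)
      then show False using x off_J[of i j] by (simp add: T_iff)
    qed
  qed
  finally show ?thesis
    using card_triangle[OF fin h]
    by (simp add: T_def J_def card_lower_pairs[OF A D] card_adapted_piece[OF A D] dim_piece)
qed

section \<open>The Hodge filtration\<close>

abbreviation F :: "int \<Rightarrow> ('v \<times> 'v) set" where "F \<equiv> hodge_filtration n H"

lemma zero_if_proj_zero: "(\<And>r. proj r v = 0) \<Longrightarrow> v = 0"
  using sum_proj[of v] by simp

lemma subspace_proj_zero: "cx.subspace {v. \<forall>r\<in>R. proj r v = 0}"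
  by (simp add: cx.subspace_def proj_add proj_scale)

lemma mem_F_iff: "v \<in> F p \<longleftrightarrow> (\<forall>r<p. proj r v = 0)"
proof
  have "(\<Union>r\<in>{p..}. H r (n - r)) \<subseteq> {v. \<forall>r\<in>{..<p}. proj r v = 0}"
    by (auto simp: H_eq_piece proj_piece)
  then have "F p \<subseteq> {v. \<forall>r\<in>{..<p}. proj r v = 0}"
    unfolding hodge_filtration_def by (rule cx.span_minimal[OF _ subspace_proj_zero])
  then show "v \<in> F p \<Longrightarrow> \<forall>r<p. proj r v = 0" by blast
next
  assume v: "\<forall>r<p. proj r v = 0"
  have "proj r v \<in> F p" for r
  proof (cases "r < p")
    case False
    have "proj r v \<in> H r (n - r)" using proj_mem[of r v] by (simp add: H_eq_piece)
    then show ?thesis using False unfolding hodge_filtration_def by (intro cx.span_base) auto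
  qed (use v in \<open>simp add: hodge_filtration_def cx.span_zero\<close>)
  then show "v \<in> F p"
    by (subst sum_proj[of v, symmetric]) (simp add: hodge_filtration_def cx.span_sum)
qed

lemma subspace_F: "cx.subspace (F p)"
  by (simp add: hodge_filtration_def)

lemma F_antimono: "p \<le> q \<Longrightarrow> F q \<subseteq> F p"
  by (auto simp: mem_F_iff)

lemma piece_subset_F: "p \<le> r \<Longrightarrow> piece r \<subseteq> F p"
  by (auto simp: mem_F_iff proj_piece)

text \<open>A component of \<open>v\<close> pairs with \<open>F p\<close> as soon as its complementary Hodge space lies in \<open>F p\<close>.\<close>

lemma perp_F: "perp Q (F p) = F (n - p + 1)"
proof (intro equalityI subsetI)
  fix v assume v: "v \<in> perp Q (F p)"
  have "proj r v = 0" if "r < n - p + 1" for r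
  proof (rule proj_eq_0I)
    fix w assume "w \<in> piece (n - r)"
    then have "w \<in> F p" using piece_subset_F[of p "n - r"] that by auto
    then show "\<beta> v w = 0" using v \<beta>_eq_0_sym[of v w] by (simp add: perp_def)
  qed
  then show "v \<in> F (n - p + 1)" by (simp add: mem_F_iff)
next
  fix v assume v: "v \<in> F (n - p + 1)"
  have "\<beta> u v = 0" if u: "u \<in> F p" for u
  proof -
    have "\<beta> u v = (\<Sum>r\<in>{0..n}. \<beta> u (proj r v))"
      by (subst sum_proj[of v, symmetric]) (rule \<beta>_sum_right)
    also have "\<dots> = 0"
    proof (rule sum.neutral, rule ballI)
      fix r
      show "\<beta> u (proj r v) = 0"
      proof (cases "r < n - p + 1")
        case True
        then show ?thesis using v by (simp add: mem_F_iff)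
      next
        case False
        then have "proj (n - r) u = 0" using u by (simp add: mem_F_iff)
        then show ?thesis using \<beta>_proj(1)[OF proj_mem, of u r v] by simp
      qed
    qed
    finally show ?thesis .
  qed
  then show "v \<in> perp Q (F p)" by (simp add: perp_def)
qed

lemma F_eq_span: "F p = cx.span (F (p + 1) \<union> piece p)"
proof
  have "F (p + 1) \<union> piece p \<subseteq> F p" using F_antimono[of p "p + 1"] piece_subset_F[of p p] by auto
  then show "cx.span (F (p + 1) \<union> piece p) \<subseteq> F p" by (rule cx.span_minimal[OF _ subspace_F])
  show "F p \<subseteq> cx.span (F (p + 1) \<union> piece p)"
  proof
    fix v assume v: "v \<in> F p"
    have "proj r (v - proj p v) = 0" if "r < p + 1" for r
      using v that proj_piece[OF proj_mem, of r p v] by (cases "r = p") (simp_all add: mem_F_iff proj_diff)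
    then have "v - proj p v \<in> F (p + 1)" by (simp add: mem_F_iff)
    then have "(v - proj p v) + proj p v \<in> cx.span (F (p + 1) \<union> piece p)"
      using proj_mem[of p v] by (intro cx.span_add cx.span_base) auto
    then show "v \<in> cx.span (F (p + 1) \<union> piece p)" by simp
  qed
qed

section \<open>Tangent vectors of the compact dual\<close>

text \<open>The representatives of tangent vectors strictly lower the Hodge degree.\<close>

lemma negative_part:
  assumes "X \<in> endo.span (\<Union>r\<in>{..<0}. isometry_component n H Q r (- r))"
  shows "X \<in> isometry_algebra Q" and "v \<in> piece p \<Longrightarrow> p \<le> r \<Longrightarrow> proj r (X v) = 0"
proof -
  define U where "U = {X \<in> isometry_algebra Q. \<forall>p r. \<forall>v\<in>piece p. p \<le> r \<longrightarrow> proj r (X v) = 0}"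
  have "endo.subspace U"
    using subspace_isometry_algebra
    by (simp add: U_def endo.subspace_def escale_def proj_add proj_scale)
  moreover have "(\<Union>r\<in>{..<0}. isometry_component n H Q r (- r)) \<subseteq> U"
  proof
    fix X assume "X \<in> (\<Union>r\<in>{..<0}. isometry_component n H Q r (- r))"
    then obtain s where s: "s < 0" "X \<in> isometry_component n H Q s (- s)" by auto
    have "proj r (X v) = 0" if "v \<in> piece p" "p \<le> r" for p r v
    proof -
      have "X v \<in> piece (p + s)" using s that by (simp add: component_iff)
      then show ?thesis using s(1) that(2) by (simp add: proj_piece)
    qed
    then show "X \<in> U" using s by (simp add: U_def component_iff)
  qed
  ultimately have "X \<in> U" using assms endo.span_minimal by blast
  then show "X \<in> isometry_algebra Q" "v \<in> piece p \<Longrightarrow> p \<le> r \<Longrightarrow> proj r (X v) = 0"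
    by (simp_all add: U_def)
qed

text \<open>The components of nonnegative degree raise the Hodge degree, hence preserve the filtration.\<close>

lemma stabiliser_part:
  assumes "Y \<in> endo.span (\<Union>r\<in>{0..}. isometry_component n H Q r (- r))" and v: "v \<in> F p"
  shows "Y v \<in> F p"
proof -
  define U where "U = {Y. \<forall>p. \<forall>v\<in>F p. Y v \<in> F p}"
  have "endo.subspace U"
    using cx.subspace_0[OF subspace_F] cx.subspace_add[OF subspace_F] cx.subspace_scale[OF subspace_F]
    by (simp add: U_def endo.subspace_def escale_def)
  moreover have "(\<Union>r\<in>{0..}. isometry_component n H Q r (- r)) \<subseteq> U"
  proof
    fix X assume "X \<in> (\<Union>r\<in>{0..}. isometry_component n H Q r (- r))"
    then obtain s where s: "0 \<le> s" "X \<in> isometry_component n H Q s (- s)" by auto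
    then have XA: "X \<in> isometry_algebra Q" and X: "\<And>p v. v \<in> piece p \<Longrightarrow> X v \<in> piece (p + s)"
      by (simp_all add: component_iff)
    have "X v \<in> F p" if v: "v \<in> F p" for p v
    proof -
      have "X (proj r v) \<in> F p" for r
      proof (cases "r < p")
        case True
        then show ?thesis using v alg_zero[OF XA] cx.subspace_0[OF subspace_F] by (simp add: mem_F_iff)
      next
        case False
        then show ?thesis using X[OF proj_mem[of r v]] piece_subset_F[of p "r + s"] s(1) by auto
      qed
      then show ?thesis
        by (subst sum_proj[of v, symmetric]) (simp add: alg_sum[OF XA] cx.subspace_sum[OF subspace_F])
    qed
    then show "X \<in> U" by (simp add: U_def)
  qed
  ultimately have "Y \<in> U" using assms(1) endo.span_minimal by blast
  then show ?thesis using v by (simp add: U_def)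
qed

text \<open>For \<open>X\<close> of square zero this is the exponential of \<open>c X\<close>.\<close>

definition unipotent :: "('v \<times> 'v \<Rightarrow> 'v \<times> 'v) \<Rightarrow> complex \<Rightarrow> 'v \<times> 'v \<Rightarrow> 'v \<times> 'v" where
  "unipotent X c v = v + cscale c (X v)"

lemma unipotent_isometry:
  fixes X c
  assumes X: "X \<in> isometry_algebra Q" and XX: "\<And>v. X (X v) = 0"
  defines "g \<equiv> unipotent X"
  shows "g c \<in> isometry_group Q" and "g (- c) (g c v) = v"
    and "\<beta> (g c u) (g c v) = \<beta> u v" and "Vector_Spaces.linear cscale cscale (g c)" and "bij (g c)"
proof -
  show inv: "g (- c) (g c v) = v" for c v
    by (simp add: g_def unipotent_def alg_add[OF X] alg_scale[OF X] XX)
  show lin: "Vector_Spaces.linear cscale cscale (g c)"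
    unfolding g_def unipotent_def by (rule clinearI) (simp_all add: alg_add[OF X] alg_scale[OF X]
        cx.scale_right_distrib mult.commute)
  have "\<beta> (X u) (X v) = 0" for u v using alg_skew[OF X, of u "X v"] by (simp add: XX)
  then show pres: "\<beta> (g c u) (g c v) = \<beta> u v" for u v
    by (simp add: g_def unipotent_def \<beta>_add_left \<beta>_add_right \<beta>_scale_left \<beta>_scale_right alg_skew[OF X, of u v])
  show bij: "bij (g c)"
    by (rule o_bij[of "g (- c)"]) (use inv[of c] inv[of "- c"] in \<open>auto simp: fun_eq_iff\<close>)
  show "g c \<in> isometry_group Q" using lin bij pres unfolding isometry_group_def by blast
qed

section \<open>Naturally embedded Grassmannians\<close>

text \<open>Both kinds of Grassmannians consist of the isotropic subspaces of the dimension of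
  \<open>V\<^sup>n\<^sup>-\<^sup>k\<^sup>,\<^sup>k\<close> in \<open>V\<^sup>n\<^sup>-\<^sup>k\<^sup>,\<^sup>k + B\<close>.\<close>

context
  fixes k :: int and B :: "('v \<times> 'v) set" and W G E
  assumes k: "2 * k + 1 \<le> n" and B: "cx.subspace B" "B \<subseteq> piece (n - k - 1)"
    and B_iso: "2 * k + 1 \<noteq> n \<Longrightarrow> isotropic Q B"
  defines "W \<equiv> cx.span (piece (n - k) \<union> B)"
    and "G \<equiv> {S. cx.subspace S \<and> S \<subseteq> W \<and> isotropic Q S \<and> cx.dim S = hn k}"
    and "E \<equiv> \<lambda>S. cx.span (F (n - k + 1) \<union> S)"
begin

lemma W_subset_F: "W \<subseteq> F (n - k - 1)"
  unfolding W_def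
  using B(2) piece_subset_F[of "n - k - 1" "n - k"] piece_subset_F[of "n - k - 1" "n - k - 1"]
  by (intro cx.span_minimal[OF _ subspace_F]) auto

text \<open>The components in \<open>F (n - k + 1)\<close> and in \<open>W\<close> have different Hodge degrees. Hence \<open>S\<close> is recovered
  from \<open>E S\<close> by intersecting with \<open>W\<close>.\<close>

lemma W_disjoint_F: "F (n - k + 1) \<inter> W \<subseteq> {0}"
proof
  fix v assume v: "v \<in> F (n - k + 1) \<inter> W"
  have "W \<subseteq> {v. \<forall>r\<in>{n - k + 1..}. proj r v = 0}"
    unfolding W_def
    using B(2) by (intro cx.span_minimal[OF _ subspace_proj_zero]) (auto simp: proj_piece)
  then have "proj r v = 0" for r
    using v by (cases "r < n - k + 1") (auto simp: mem_F_iff)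
  then show "v \<in> {0}" using zero_if_proj_zero by blast
qed

text \<open>The hypothesis \<open>2 * k + 1 \<le> n\<close> says that \<open>F (n - k + 1)\<close> lies in \<open>F (k + 2)\<close>, the orthogonal
  complement of \<open>F (n - k - 1)\<close>.\<close>

lemma \<beta>_F_high:
  assumes "u \<in> F (n - k - 1)" "v \<in> F (n - k + 1)"
  shows "\<beta> u v = 0"
proof -
  have "v \<in> F (n - (n - k - 1) + 1)"
    using F_antimono[of "n - (n - k - 1) + 1" "n - k + 1"] assms(2) k by auto
  then show ?thesis using assms(1) unfolding perp_F[symmetric] perp_def by blast
qed

lemma dim_E: 
  assumes "cx.subspace S" "S \<subseteq> W" "cx.dim S = hn k"
  shows "cx.dim (E S) = cx.dim (F (n - k))"
proof -
  have "cx.dim (E S) = cx.dim (F (n - k + 1)) + hn k"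
    unfolding E_def assms(3)[symmetric]
    using W_disjoint_F assms by (intro dim_span_Un_disjoint subspace_F) auto
  moreover have "cx.dim (F (n - k)) = cx.dim (F (n - k + 1)) + cx.dim (piece (n - k))"
    unfolding F_eq_span[of "n - k"]
  proof (intro dim_span_Un_disjoint subspace_F subspace_piece)
    have "piece (n - k) \<subseteq> W" unfolding W_def using cx.span_superset by blast
    then show "F (n - k + 1) \<inter> piece (n - k) \<subseteq> {0}" using W_disjoint_F by blast
  qed
  moreover have "cx.dim (piece (n - k)) = hn k" by (simp add: hodge_number_def H_eq_piece)
  ultimately show ?thesis by simp
qed

lemma F_subset_E: "F (n - k + 1) \<subseteq> E S"
  unfolding E_def by (rule order_trans[OF _ cx.span_superset]) simp

lemma E_subset_F: "S \<subseteq> W \<Longrightarrow> E S \<subseteq> F (n - k - 1)"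
  unfolding E_def using W_subset_F F_antimono[of "n - k - 1" "n - k + 1"]
  by (intro cx.span_minimal[OF _ subspace_F]) auto

lemma E_isotropic:
  assumes "S \<subseteq> W" "isotropic Q S"
  shows "E S \<subseteq> perp Q (E S)"
proof -
  have S: "S \<subseteq> F (n - k - 1)" using assms(1) W_subset_F by blast
  have "\<beta> u v = 0" if "u \<in> F (n - k + 1) \<union> S" "v \<in> F (n - k + 1) \<union> S" for u v
  proof (cases "u \<in> S \<and> v \<in> S")
    case True
    then show ?thesis using assms(2) by (simp add: isotropic_def)
  next
    case False
    have "u \<in> F (n - k - 1)" "v \<in> F (n - k - 1)"
      using that S F_antimono[of "n - k - 1" "n - k + 1"] by auto
    moreover have "u \<in> F (n - k + 1) \<or> v \<in> F (n - k + 1)" using that False by blast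
    ultimately show ?thesis using \<beta>_F_high[of u v] \<beta>_F_high[of v u] \<beta>_eq_0_sym[of u v] by blast
  qed
  then have "F (n - k + 1) \<union> S \<subseteq> perp Q (F (n - k + 1) \<union> S)" unfolding perp_def by blast
  then show ?thesis
    unfolding E_def perp_span by (rule cx.span_minimal[OF _ subspace_perp])
qed

text \<open>In this case the steps \<open>n - k\<close> and \<open>k + 1\<close> of the flag coincide, and the isotropic \<open>E S\<close> has half
  the total dimension.\<close>

lemma E_lagrangian:
  assumes "2 * k + 1 = n" "cx.subspace S" "S \<subseteq> W" "isotropic Q S" "cx.dim S = hn k"
  shows "perp Q (E S) = E S"
proof -
  have sub: "cx.subspace (E S)" by (simp add: E_def)
  have Fp: "perp Q (F (n - k)) = F (n - k)" unfolding perp_F using assms(1) by (intro arg_cong[of _ _ F]) simp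
  have "cx.dim (perp Q (E S)) = cx.dim (E S)"
    using dim_perp[OF sub] dim_perp[OF subspace_F[of "n - k"]] dim_E[OF assms(2,3,5)] Fp by simp
  then show ?thesis
    using cxf.subspace_dim_equal[OF sub subspace_perp E_isotropic[OF assms(3,4)]] by simp
qed

lemma flag_of_eq:
  assumes "S \<in> G"
  shows "flag_of n H Q k S p = (if p = k + 1 then perp Q (E S) else if p = n - k then E S else F p)"
  using E_lagrangian[of S] assms by (auto simp: flag_of_def Let_def E_def G_def)

lemma flag_of_top: "flag_of n H Q k S (n - k) = E S"
  by (simp add: flag_of_def Let_def E_def)

lemma flag_of_inj: "inj_on (flag_of n H Q k) G"
proof (rule inj_onI)
  have *: "S = E S \<inter> W" if S: "S \<in> G" for S
  proof (intro equalityI subsetI)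
    fix v assume v: "v \<in> E S \<inter> W"
    have sub: "cx.subspace S" "S \<subseteq> W" using S by (auto simp: G_def)
    have "E S = {x + y |x y. x \<in> F (n - k + 1) \<and> y \<in> S}"
      unfolding E_def using sub(1) subspace_F by (simp add: cx.span_Un cx.span_eq_iff[THEN iffD2])
    then obtain a s where a: "v = a + s" "a \<in> F (n - k + 1)" "s \<in> S" using v by blast
    have "v - s \<in> W" using v a sub by (intro cx.subspace_diff) (auto simp: W_def)
    then have "a = 0" using a W_disjoint_F by auto
    then show "v \<in> S" using a by simp
  next
    fix v assume "v \<in> S"
    then show "v \<in> E S \<inter> W"
      using S cx.span_superset[of "F (n - k + 1) \<union> S"] by (auto simp: E_def G_def)
  qed
  fix S T assume "S \<in> G" "T \<in> G" "flag_of n H Q k S = flag_of n H Q k T"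
  then show "S = T" using *[of S] *[of T] flag_of_top[of S] flag_of_top[of T] by metis
qed

text \<open>The step \<open>k + 1\<close> lies between its neighbours because taking orthogonal complements reverses
  \<open>F (n - k + 1) \<subseteq> E S \<subseteq> F (n - k - 1)\<close>.\<close>

lemma flag_of_compact_dual:
  assumes S: "S \<in> G"
  shows "flag_of n H Q k S \<in> compact_dual n H Q"
proof -
  let ?f = "flag_of n H Q k S"
  note f = flag_of_eq[OF S]
  have SG: "cx.subspace S" "S \<subseteq> W" "isotropic Q S" "cx.dim S = hn k" using S by (auto simp: G_def)
  have sub: "cx.subspace (E S)" by (simp add: E_def)
  have EE: "E S \<subseteq> perp Q (E S)" by (rule E_isotropic[OF SG(2,3)])
  have lag: "perp Q (E S) = E S" if "k + 1 = n - k" by (rule E_lagrangian[OF _ SG]) (use that in simp)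
  have dE: "cx.dim (E S) = cx.dim (F (n - k))" by (rule dim_E[OF SG(1,2,4)])
  have Fk: "perp Q (F (n - k)) = F (k + 1)" by (simp add: perp_F)
  have "cx.dim (perp Q (E S)) = cx.dim (F (k + 1))"
    using dim_perp[OF sub] dim_perp[OF subspace_F[of "n - k"]] dE Fk by simp
  then have dim: "cx.dim (?f p) = cx.dim (F p)" for p using dE by (simp add: f)
  have subsp: "cx.subspace (?f p)" for p using sub by (simp add: f subspace_perp subspace_F)
  have perp_low: "perp Q (E S) \<subseteq> F k"
    using perp_antimono[OF F_subset_E] by (simp add: perp_F)
  have perp_high: "F (k + 1 + 1) \<subseteq> perp Q (E S)"
    using perp_antimono[OF E_subset_F[OF SG(2)]] by (simp add: perp_F add.commute)
  have mono: "?f (p + 1) \<subseteq> ?f p" for p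
  proof -
    consider "p = k" | "p = k + 1" | "p = n - k" "p \<noteq> k + 1" | "p = n - k - 1" "p \<noteq> k" "p \<noteq> k + 1"
      | "p \<notin> {k, k + 1, n - k, n - k - 1}" by blast
    then show ?thesis
    proof cases
      case 1
      then show ?thesis using perp_low k by (simp add: f)
    next
      case 2
      then show ?thesis using perp_high EE by (simp add: f)
    next
      case 3
      then show ?thesis using F_subset_E k by (simp add: f)
    next
      case 4
      then show ?thesis using E_subset_F[OF SG(2)] by (simp add: f)
    next
      case 5
      then show ?thesis using F_antimono[of p "p + 1"] by (simp add: f)
    qed
  qed
  have "?f (n - p + 1) = perp Q (?f p)" for p
  proof -
    consider "p = k + 1" | "p = n - k" "p \<noteq> k + 1" | "p \<noteq> k + 1" "p \<noteq> n - k" by blast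
    then show ?thesis
    proof cases
      case 1
      then show ?thesis using lag perp_perp[OF sub] by (auto simp: f)
    next
      case 2
      then show ?thesis by (simp add: f)
    next
      case 3
      then show ?thesis by (auto simp: f perp_F)
    qed
  qed
  then show ?thesis unfolding compact_dual_def using subsp dim mono by blast
qed

text \<open>\<open>X\<close> is nonzero only on \<open>piece (n - k)\<close> and \<open>piece (k + 1)\<close>. Two steps can be nonzero only if the
  first one ends in \<open>piece (k + 1)\<close>, that is, if \<open>n = 2 * k + 2\<close>, and then the isotropy of \<open>B\<close>
  makes \<open>X\<close> vanish on \<open>B\<close>.\<close>

lemma block_square_zero:
  assumes X: "X \<in> block n H Q k B"
  shows "X (X v) = 0"
proof -
  have XC: "X \<in> isometry_component n H Q (-1) 1" "\<And>v. v \<in> piece (n - k) \<Longrightarrow> X v \<in> B"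
      "\<And>p v. p \<noteq> n - k \<Longrightarrow> p \<noteq> k + 1 \<Longrightarrow> v \<in> piece p \<Longrightarrow> X v = 0"
    using X by (auto simp: block_iff)
  then have XA: "X \<in> isometry_algebra Q" and lower: "\<And>p v. v \<in> piece p \<Longrightarrow> X v \<in> piece (p - 1)"
    by (auto simp: component_iff_lower)
  have "X (X v) = 0" if v: "v \<in> piece p" for p v
  proof -
    \<comment> \<open>In the second case \<open>X v\<close> lies in a Hodge space on which \<open>X\<close> vanishes.\<close>
    consider "p = k + 1" | "p = n - k" "n - k - 1 \<noteq> k + 1" "p \<noteq> k + 1" | "p = n - k" "n - k - 1 = k + 1"
      | "p \<noteq> n - k" "p \<noteq> k + 1" by blast
    then show ?thesis
    proof cases
      case 1
      then show ?thesis using XC(3)[OF _ _ lower[OF v]] k by simp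
    next
      case 2
      then show ?thesis using XC(3)[OF _ _ lower[OF v]] by simp
    next
      case 3
      have "proj r (X (X v)) = 0" for r
      proof (cases "r = k")
        case True
        show ?thesis
        proof (rule proj_eq_0I)
          fix w assume "w \<in> piece (n - r)"
          then have "X w \<in> B" using XC(2) True by simp
          moreover have "X v \<in> B" using XC(2) v 3 by simp
          moreover have "isotropic Q B" using B_iso 3 by simp
          ultimately have "\<beta> (X v) (X w) = 0" by (simp add: isotropic_def)
          then show "\<beta> (X (X v)) w = 0" by (simp add: alg_skew[OF XA])
        qed
      next
        case False
        then show ?thesis using proj_piece[OF lower[OF lower[OF v]], of r] 3 by simp
      qed
      then show ?thesis by (rule zero_if_proj_zero)
    next
      case 4
      then show ?thesis using XC(3)[OF _ _ v] alg_zero[OF XA] by simp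
    qed
  qed
  from this[OF proj_mem] show ?thesis
    by (subst sum_proj[of v, symmetric]) (simp add: alg_sum[OF XA])
qed

text \<open>The curve is \<open>t \<mapsto> 1 + t X\<close>; the subspace \<open>S\<close> at time \<open>t\<close> is the image of \<open>piece (n - k)\<close>.\<close>

lemma block_subset_tangent:
  assumes X: "X \<in> block n H Q k B"
  shows "X \<in> tangent_space n H Q (flag_of n H Q k ` G)"
proof -
  have XC: "X \<in> isometry_component n H Q (-1) 1" "\<And>v. v \<in> piece (n - k) \<Longrightarrow> X v \<in> B"
      "\<And>p v. p \<noteq> n - k \<Longrightarrow> p \<noteq> k + 1 \<Longrightarrow> v \<in> piece p \<Longrightarrow> X v = 0"
    using X by (auto simp: block_iff)
  then have XA: "X \<in> isometry_algebra Q" and lower: "\<And>p v. v \<in> piece p \<Longrightarrow> X v \<in> piece (p - 1)"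
    by (auto simp: component_iff_lower)
  define g where "g = unipotent X"
  have g_def': "g c v = v + cscale c (X v)" for c v by (simp add: g_def unipotent_def)
  note g = unipotent_isometry[OF XA block_square_zero[OF X], folded g_def]
  have X_F: "X v \<in> F p" if p: "p \<noteq> n - k" "p \<noteq> k + 1" and v: "v \<in> F p" for p v
  proof -
    have "X (proj r v) \<in> F p" for r
    proof (cases "r \<le> p")
      case True
      then have "X (proj r v) = 0"
        using XC(3)[OF p proj_mem] v alg_zero[OF XA] by (cases "r = p") (auto simp: mem_F_iff)
      then show ?thesis by (simp add: cx.subspace_0 subspace_F)
    next
      case False
      then show ?thesis using lower[OF proj_mem[of r v]] piece_subset_F[of p "r - 1"] by auto
    qed
    then show ?thesis
      by (subst sum_proj[of v, symmetric]) (simp add: alg_sum[OF XA] cx.subspace_sum[OF subspace_F])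
  qed
  have g_F: "g c ` F p = F p" if p: "p \<noteq> n - k" "p \<noteq> k + 1" for c p
  proof -
    have sub: "g c v \<in> F p" if "v \<in> F p" for c v
      using X_F[OF p that] that by (simp add: g_def' cx.subspace_add cx.subspace_scale subspace_F)
    have "v \<in> g c ` F p" if "v \<in> F p" for v
      by (rule image_eqI[of _ "g c", OF g(2)[of "- c", unfolded minus_minus, symmetric] sub[OF that]])
    then show ?thesis using sub by blast
  qed
  have X_high: "X v = 0" if v: "v \<in> F (n - k + 1)" for v
  proof -
    have "X (proj r v) = 0" for r
      using v XC(3)[OF _ _ proj_mem, of r v] alg_zero[OF XA] k
      by (cases "r < n - k + 1") (auto simp: mem_F_iff)
    then show ?thesis
      by (subst sum_proj[of v, symmetric]) (simp add: alg_sum[OF XA])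
  qed
  have flag: "\<exists>S\<in>G. (\<lambda>p. g c ` F p) = flag_of n H Q k S" for c
  proof
    let ?S = "g c ` piece (n - k)"
    have inj: "inj (g c)" using g(5) by (rule bij_is_inj)
    show S: "?S \<in> G"
      unfolding G_def mem_Collect_eq
    proof (intro conjI)
      show "cx.subspace ?S" by (rule cxp.linear_subspace_image[OF g(4) subspace_piece])
      show "?S \<subseteq> W"
      proof
        fix s assume "s \<in> ?S"
        then obtain v where v: "v \<in> piece (n - k)" "s = g c v" by blast
        then show "s \<in> W" using XC(2)[OF v(1)] unfolding W_def g_def'
          by (auto intro!: cx.span_add cx.span_scale intro: cx.span_base)
      qed
      show "isotropic Q ?S"
        using piece_orthogonal[of _ "n - k" _ "n - k"] k by (auto simp: isotropic_def g(3))
      have "cx.dim ?S = cx.dim (piece (n - k))"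
        by (rule cxp.dim_image_eq[OF g(4)]) (rule inj_on_subset[OF inj subset_UNIV])
      then show "cx.dim ?S = hn k" by (simp add: hodge_number_def H_eq_piece)
    qed
    have "g c ` F (n - k + 1) = F (n - k + 1)"
      using X_high by (auto simp: g_def' image_iff)
    then have top: "g c ` F (n - k) = E ?S"
      unfolding E_def F_eq_span[of "n - k"] cxp.linear_span_image[OF g(4), symmetric] image_Un by simp
    have "perp Q (E ?S) = g c ` perp Q (F (n - k))"
      unfolding top[symmetric] by (rule perp_image_isometry[OF g(3) bij_is_surj[OF g(5)]])
    also have "perp Q (F (n - k)) = F (k + 1)" by (simp add: perp_F)
    finally show "(\<lambda>p. g c ` F p) = flag_of n H Q k ?S"
      using top g_F by (auto simp: fun_eq_iff flag_of_eq[OF S])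
  qed
  have "((\<lambda>t. v + t *\<^sub>R X v) has_vector_derivative X v) (at (0::real))" for v
    by (auto intro!: derivative_eq_intros)
  then have "\<forall>v. ((\<lambda>t. g (complex_of_real t) v) has_vector_derivative X v + 0 v) (at 0)"
    by (simp add: g_def' scaleR_eq_cscale)
  moreover have "\<forall>\<^sub>F t in nhds 0. g (complex_of_real t) \<in> isometry_group Q \<and>
      (\<lambda>p. g (complex_of_real t) ` F p) \<in> flag_of n H Q k ` G"
    using g(1) flag by (intro always_eventually) blast
  moreover have "g (complex_of_real 0) = id" by (simp add: g_def' fun_eq_iff)
  moreover have "0 \<in> endo.span (\<Union>r\<in>{0..}. isometry_component n H Q r (- r))"
    by (rule endo.span_zero)
  moreover have "X \<in> endo.span (\<Union>r\<in>{..<0}. isometry_component n H Q r (- r))"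
    using XC(1) by (intro endo.span_base UN_I[of "-1"]) auto
  ultimately show ?thesis
    unfolding tangent_space_def mem_Collect_eq
    by (intro conjI exI[of _ "\<lambda>t. g (complex_of_real t)"] bexI[of _ 0]) assumption+
qed

text \<open>The vector \<open>Y\<close> preserves every step of the filtration, so membership of the velocity \<open>X + Y\<close> in
  a subspace containing the step passes to \<open>X\<close>. Together with the strict lowering of the Hodge
  degree this leaves room in a single degree.\<close>

lemma tangent_subset_block:
  assumes X: "X \<in> tangent_space n H Q (flag_of n H Q k ` G)"
  shows "X \<in> block n H Q k B"
proof -
  obtain g Y where neg: "X \<in> endo.span (\<Union>r\<in>{..<0}. isometry_component n H Q r (- r))"
    and Y: "Y \<in> endo.span (\<Union>r\<in>{0..}. isometry_component n H Q r (- r))"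
    and deriv: "\<And>v. ((\<lambda>t. g t v) has_vector_derivative X v + Y v) (at (0::real))"
    and ev: "\<forall>\<^sub>F t in nhds 0. g t \<in> isometry_group Q \<and> (\<lambda>p. g t ` F p) \<in> flag_of n H Q k ` G"
    using X unfolding tangent_space_def by blast
  have velocity: "X v \<in> U"
    if v: "v \<in> F p" and U: "cx.subspace U" "F p \<subseteq> U" "\<And>S. S \<in> G \<Longrightarrow> flag_of n H Q k S p \<subseteq> U"
    for p v U
  proof -
    have "\<forall>\<^sub>F t in nhds 0. g t v \<in> U"
      using ev
    proof (rule eventually_mono)
      fix t assume "g t \<in> isometry_group Q \<and> (\<lambda>p. g t ` F p) \<in> flag_of n H Q k ` G"
      then obtain S where S: "S \<in> G" "(\<lambda>p. g t ` F p) = flag_of n H Q k S" by blast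
      then have "g t ` F p = flag_of n H Q k S p" by (simp add: fun_eq_iff)
      then show "g t v \<in> U" using v U(3)[OF S(1)] by blast
    qed
    then have "X v + Y v \<in> U" by (rule velocity_in_subspace[OF U(1) deriv])
    moreover have "Y v \<in> U" using stabiliser_part[OF Y v] U(2) by blast
    ultimately have "(X v + Y v) - Y v \<in> U" by (rule cx.subspace_diff[OF U(1)])
    then show ?thesis by simp
  qed
  have XA: "X \<in> isometry_algebra Q" by (rule negative_part(1)[OF neg])
  note up = negative_part(2)[OF neg]
  have zero: "X v = 0" if p: "p \<noteq> n - k" "p \<noteq> k + 1" and v: "v \<in> piece p" for p v
  proof -
    have vF: "v \<in> F p" using v piece_subset_F by blast
    have "X v \<in> F p"
      by (rule velocity[OF vF subspace_F order_refl]) (use p in \<open>simp add: flag_of_eq\<close>)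
    then have "proj r (X v) = 0" for r
      using up[OF v, of r] by (cases "r < p") (auto simp: mem_F_iff)
    then show ?thesis by (rule zero_if_proj_zero)
  qed
  have top: "X v \<in> B" if v: "v \<in> piece (n - k)" for v
  proof -
    have vF: "v \<in> F (n - k)" using v piece_subset_F by blast
    have "X v \<in> cx.span (F (n - k) \<union> B)"
    proof (rule velocity[OF vF])
      show "F (n - k) \<subseteq> cx.span (F (n - k) \<union> B)" using cx.span_superset by blast
      show "flag_of n H Q k S (n - k) \<subseteq> cx.span (F (n - k) \<union> B)" if "S \<in> G" for S
      proof -
        have "W \<subseteq> cx.span (F (n - k) \<union> B)"
          unfolding W_def using piece_subset_F[of "n - k" "n - k"] by (intro cx.span_mono) blast
        moreover have "F (n - k + 1) \<subseteq> cx.span (F (n - k) \<union> B)"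
          using F_antimono[of "n - k" "n - k + 1"] cx.span_superset by fastforce
        ultimately show ?thesis
          unfolding flag_of_top E_def using that
          by (intro cx.span_minimal[OF _ cx.subspace_span]) (auto simp: G_def)
      qed
    qed simp
    then obtain a b where ab: "X v = a + b" "a \<in> F (n - k)" "b \<in> B"
      using B(1) subspace_F unfolding cx.span_Un by (auto simp: cx.span_eq_iff[THEN iffD2])
    have "proj r a = 0" for r
    proof (cases "r < n - k")
      case True
      then show ?thesis using ab by (simp add: mem_F_iff)
    next
      case False
      then have "proj r b = 0" using ab(3) B(2) by (auto simp: proj_piece)
      then show ?thesis using up[OF v, of r] False by (simp add: ab(1) proj_add)
    qed
    then have "a = 0" by (rule zero_if_proj_zero)
    then show ?thesis using ab by simp
  qed
  have dual: "X v \<in> piece k" if v: "v \<in> piece (k + 1)" for v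
  proof -
    have vF: "v \<in> F (k + 1)" using v piece_subset_F by blast
    have "X v \<in> F k"
    proof (rule velocity[OF vF subspace_F])
      show "F (k + 1) \<subseteq> F k" by (rule F_antimono) simp
      show "flag_of n H Q k S (k + 1) \<subseteq> F k" if "S \<in> G" for S
      proof -
        from perp_antimono[OF F_subset_E] show ?thesis using that by (simp add: flag_of_eq perp_F)
      qed
    qed
    then have "proj r (X v) = 0" if "r \<noteq> k" for r
      using up[OF v, of r] that by (cases "r < k") (auto simp: mem_F_iff)
    then show ?thesis by (simp add: mem_piece_iff)
  qed
  have "X v \<in> piece (p - 1)" if v: "v \<in> piece p" for p v
  proof -
    consider "p = n - k" | "p = k + 1" | "p \<noteq> n - k" "p \<noteq> k + 1" by blast
    then show ?thesis
    proof cases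
      case 1
      then show ?thesis using subsetD[OF B(2) top] v by simp
    next
      case 2
      then show ?thesis using dual v by simp
    next
      case 3
      then show ?thesis using zero[OF 3 v] by (simp add: cx.subspace_0 subspace_piece)
    qed
  qed
  then have "X \<in> isometry_component n H Q (-1) 1" using XA by (simp add: component_iff_lower)
  then show ?thesis using top zero unfolding block_iff by blast
qed

lemma naturally_embedded_isotropic: "naturally_embedded n H Q k B G"
  unfolding naturally_embedded_def
  using flag_of_inj flag_of_compact_dual block_subset_tangent tangent_subset_block by blast

end

lemma embedded_dim_eq:
  "naturally_embedded n H Q k B G \<Longrightarrow> embedded_dim n H Q k G = endo.dim (block n H Q k B)"
  by (simp add: naturally_embedded_def embedded_dim_def)

text \<open>Here \<open>piece (n - k) + B\<close> is isotropic itself, so isotropy is no condition on its subspaces.\<close>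

lemma A_grassmannian_embedded:
  assumes k: "2 * k + 1 < n" and B: "cx.subspace B" "B \<subseteq> piece (n - k - 1)" "isotropic Q B"
  shows "naturally_embedded n H Q k B (A_grassmannian n H k B)"
    and "embedded_dim n H Q k (A_grassmannian n H k B) = hn k * cx.dim B"
proof -
  let ?W = "cx.span (piece (n - k) \<union> B)"
  have "\<beta> u v = 0" if "u \<in> piece (n - k)" "v \<in> piece (n - k) \<union> B" for u v
    using that B(2) k piece_orthogonal[OF that(1), of v "n - k"]
      piece_orthogonal[OF that(1), of v "n - k - 1"] by auto
  then have "piece (n - k) \<union> B \<subseteq> perp Q (piece (n - k) \<union> B)"
    using B(3) \<beta>_eq_0_sym unfolding perp_def isotropic_def by blast
  then have "?W \<subseteq> perp Q ?W"
    unfolding perp_span by (rule cx.span_minimal[OF _ subspace_perp])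
  then have iso: "isotropic Q S" if "S \<subseteq> ?W" for S
    using that unfolding isotropic_def perp_def by blast
  have "A_grassmannian n H k B
      = {S. cx.subspace S \<and> S \<subseteq> ?W \<and> isotropic Q S \<and> cx.dim S = hn k}"
    using iso by (auto simp: A_grassmannian_def grassmannian_def H_eq_piece)
  moreover have "naturally_embedded n H Q k B
      {S. cx.subspace S \<and> S \<subseteq> ?W \<and> isotropic Q S \<and> cx.dim S = hn k}"
    by (rule naturally_embedded_isotropic) (use k B in auto)
  ultimately show *: "naturally_embedded n H Q k B (A_grassmannian n H k B)" by simp
  show "embedded_dim n H Q k (A_grassmannian n H k B) = hn k * cx.dim B"
    using embedded_dim_eq[OF *] dim_block[OF B(1,2)] k by simp
qed

lemma full_block_embedded:
  assumes "2 * k + 2 < n"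
  defines "B \<equiv> H (n - k - 1) (k + 1)"
  shows "naturally_embedded n H Q k B (A_grassmannian n H k B)"
    and "embedded_dim n H Q k (A_grassmannian n H k B) = hn k * hn (k + 1)"
proof -
  have B: "B = piece (n - k - 1)" by (simp add: B_def H_eq_piece)
  have "isotropic Q B"
    using assms(1) piece_orthogonal[of _ "n - k - 1" _ "n - k - 1"] by (auto simp: isotropic_def B)
  moreover have "cx.dim B = hn (k + 1)"
    by (simp add: hodge_number_def B_def algebra_simps)
  ultimately show "naturally_embedded n H Q k B (A_grassmannian n H k B)"
    and "embedded_dim n H Q k (A_grassmannian n H k B) = hn k * hn (k + 1)"
    using A_grassmannian_embedded[of k B] assms(1) subspace_piece by (simp_all add: B)
qed

lemma C_grassmannian_embedded:
  assumes n: "n = 2 * k + 1"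
  shows "naturally_embedded n H Q k (H k (k + 1)) (C_grassmannian n H Q k)"
    and "2 * embedded_dim n H Q k (C_grassmannian n H Q k) = hn k * (hn k + 1)"
proof -
  let ?W = "cx.span (piece (n - k) \<union> piece k)"
  have B: "H k (k + 1) = piece k" using n by (intro H_eq_piece) simp
  have "piece (n - k) \<inter> piece k \<subseteq> {0}" using pieces_disjoint[of _ "n - k" k] n by auto
  then have "cx.dim ?W = cx.dim (piece (n - k)) + cx.dim (piece k)"
    by (intro dim_span_Un_disjoint subspace_piece)
  also have "cx.dim (piece (n - k)) = hn k" by (simp add: hodge_number_def H_eq_piece)
  finally have dW: "cx.dim ?W = 2 * hn k" by (simp add: dim_piece)
  have "H (n - k) k = piece (n - k)" "H (n - k - 1) (k + 1) = piece k"
    using n by (auto simp: H_eq_piece)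
  then have "C_grassmannian n H Q k
      = {S. cx.subspace S \<and> S \<subseteq> ?W \<and> isotropic Q S \<and> cx.dim S = hn k}"
    using dW by (auto simp: C_grassmannian_def lagrangian_grassmannian_def)
  moreover have "naturally_embedded n H Q k (piece k)
      {S. cx.subspace S \<and> S \<subseteq> ?W \<and> isotropic Q S \<and> cx.dim S = hn k}"
    by (rule naturally_embedded_isotropic) (use n subspace_piece in auto)
  ultimately have *: "naturally_embedded n H Q k (piece k) (C_grassmannian n H Q k)" by simp
  then show "naturally_embedded n H Q k (H k (k + 1)) (C_grassmannian n H Q k)" by (simp add: B)
  show "2 * embedded_dim n H Q k (C_grassmannian n H Q k) = hn k * (hn k + 1)"
    using embedded_dim_eq[OF *] dim_symmetric_block[OF n] by simp
qed

text \<open>This fixes the parity of the dimension of \<open>W\<close>.\<close>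

lemma dim_splitting:
  assumes W: "isotropic_splitting Q W V1 V2 L"
  shows "cx.dim W = 2 * (cx.dim W div 2) + cx.dim L"
proof -
  have sub: "cx.subspace V1" "cx.subspace V2" "cx.subspace L"
    and bij: "bij_betw (\<lambda>(x, y, z). x + y + z) (V1 \<times> V2 \<times> L) W"
    and dims: "cx.dim V1 = cx.dim W div 2" "cx.dim V2 = cx.dim W div 2"
    using W by (auto simp: isotropic_splitting_def maximal_isotropic_def)
  have uniq: "x = x' \<and> y = y' \<and> z = z'"
    if "x \<in> V1" "y \<in> V2" "z \<in> L" "x' \<in> V1" "y' \<in> V2" "z' \<in> L" "x + y + z = x' + y' + z'"
    for x y z x' y' z'
    using inj_onD[OF bij_betw_imp_inj_on[OF bij], of "(x, y, z)" "(x', y', z')"] that by simp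
  note zero = sub[THEN cx.subspace_0]
  let ?S = "cx.span (V1 \<union> V2)"
  have S: "?S = {x + y |x y. x \<in> V1 \<and> y \<in> V2}"
    using sub by (simp add: cx.span_Un cx.span_eq_iff[THEN iffD2])
  have "W = (\<lambda>(x, y, z). x + y + z) ` (V1 \<times> V2 \<times> L)" using bij by (simp add: bij_betw_def)
  also have "\<dots> = {s + z |s z. s \<in> ?S \<and> z \<in> L}" unfolding S by force
  also have "\<dots> = cx.span (?S \<union> L)"
    using sub by (simp add: cx.span_Un[of ?S L] cx.span_span cx.span_eq_iff[THEN iffD2])
  finally have "cx.dim W = cx.dim (cx.span (?S \<union> L))" by simp
  also have "\<dots> = cx.dim ?S + cx.dim L"
  proof (rule dim_span_Un_disjoint)
    show "?S \<inter> L \<subseteq> {0}"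
    proof
      fix z assume z: "z \<in> ?S \<inter> L"
      then obtain x y where "x \<in> V1" "y \<in> V2" "z = x + y" unfolding S by blast
      then show "z \<in> {0}" using uniq[of x y 0 0 0 z] z zero by simp
    qed
  qed (use sub in simp_all)
  also have "cx.dim ?S = cx.dim V1 + cx.dim V2"
  proof (rule dim_span_Un_disjoint)
    show "V1 \<inter> V2 \<subseteq> {0}"
    proof
      fix x assume "x \<in> V1 \<inter> V2"
      then show "x \<in> {0}" using uniq[of x 0 0 0 x 0] zero by simp
    qed
  qed (use sub in simp_all)
  finally show ?thesis using dims by linarith
qed

lemma isotropic_half_embedded:
  assumes n: "n = 2 * m" and W: "isotropic_splitting Q (H m m) V1 V2 L" and B: "B \<in> {V1, V2}"
  shows "naturally_embedded n H Q (m - 1) B (A_grassmannian n H (m - 1) B)"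
    and "2 * embedded_dim n H Q (m - 1) (A_grassmannian n H (m - 1) B) + hn (m - 1) * cx.dim L
      = hn (m - 1) * hn m"
proof -
  have H: "H m m = piece m" "cx.dim (H m m) = hn m" using n by (auto simp: H_eq_piece hodge_number_def)
  have B': "cx.subspace B" "B \<subseteq> piece (n - (m - 1) - 1)" "isotropic Q B" "cx.dim B = hn m div 2"
    using W B H n by (auto simp: isotropic_splitting_def maximal_isotropic_def)
  have m: "2 * (m - 1) + 1 < n" using n by simp
  show "naturally_embedded n H Q (m - 1) B (A_grassmannian n H (m - 1) B)"
    by (rule A_grassmannian_embedded(1)[OF m B'(1-3)])
  have "hn m = 2 * (hn m div 2) + cx.dim L" using dim_splitting[OF W] H by simp
  then have "hn (m - 1) * hn m = hn (m - 1) * (2 * (hn m div 2) + cx.dim L)" by simp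
  then show "2 * embedded_dim n H Q (m - 1) (A_grassmannian n H (m - 1) B) + hn (m - 1) * cx.dim L
      = hn (m - 1) * hn m"
    by (simp add: A_grassmannian_embedded(2)[OF m B'(1-3)] B'(4) algebra_simps)
qed

lemma dim_lower_component_even_split:
  assumes n: "n = 2 * m"
  shows "endo.dim (isometry_component n H Q (-1) 1)
    = (\<Sum>k\<in>{0..m - 2}. hn k * hn (k + 1)) + hn (m - 1) * hn m"
proof (cases "m = 0")
  case True
  have "piece (m - 1) = {0}" by (rule piece_outside) (use True in simp)
  then have "hn (m - 1) = 0" using dim_piece[of "m - 1"] by simp
  then show ?thesis using dim_lower_component_even[OF n] True by simp
next
  case False
  have "0 \<le> n" using hodge by (simp add: hodge_structure_def)
  then have "{0..m - 1} = insert (m - 1) {0..m - 2}" using False n by auto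
  then show ?thesis using dim_lower_component_even[OF n] by simp
qed

end

text \<open>The term \<open>f\<^sub>m\<^sub>-\<^sub>1 * f\<^sub>m\<close> of the last block splits into the two halves and, in type (B), the
  summand of \<open>Hom (V\<^sup>m\<^sup>+\<^sup>1\<^sup>,\<^sup>m\<^sup>-\<^sup>1, L)\<close>.\<close>

theorem corollary16:
  fixes H :: "int \<Rightarrow> int \<Rightarrow> ('v::euclidean_space \<times> 'v) set"
    and Q :: "'v \<Rightarrow> 'v \<Rightarrow> real"
    and n m :: int and l :: nat
    and f :: "int \<Rightarrow> nat"
  assumes "hodge_structure n H"
    and "polarisation n H Q"
    and "f = hodge_number n H"
  shows
    "(n = 2 * m \<and> DIM('v) = 2 * l + 1 \<longrightarrow>
        real (endo.dim (isometry_component n H Q (-1) 1)) =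
          (\<Sum>k=0..m-2. real (f k) * real (f (k + 1)))
          + real (f (m - 1)) * (real (f m) - 1) / 2
          + real (f (m - 1)) * (real (f m) - 1) / 2
          + real (f (m - 1)) \<and>
        (\<forall>k\<in>{0..m-2}.
           naturally_embedded n H Q k (H (n - k - 1) (k + 1))
             (A_grassmannian n H k (H (n - k - 1) (k + 1))) \<and>
           embedded_dim n H Q k (A_grassmannian n H k (H (n - k - 1) (k + 1)))
             = f k * f (k + 1)) \<and>
        (\<forall>V1 V2 L. isotropic_splitting Q (H m m) V1 V2 L \<and> cx.dim L = 1 \<longrightarrow>
           (\<forall>B\<in>{V1, V2}.
              naturally_embedded n H Q (m - 1) B (A_grassmannian n H (m - 1) B) \<and>
              real (embedded_dim n H Q (m - 1) (A_grassmannian n H (m - 1) B))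
                = real (f (m - 1)) * (real (f m) - 1) / 2)))
   \<and> (n = 2 * m + 1 \<and> DIM('v) = 2 * l \<longrightarrow>
        real (endo.dim (isometry_component n H Q (-1) 1)) =
          (\<Sum>k=0..m-1. real (f k) * real (f (k + 1)))
          + real (f m) * (real (f m) + 1) / 2 \<and>
        (\<forall>k\<in>{0..m-1}.
           naturally_embedded n H Q k (H (n - k - 1) (k + 1))
             (A_grassmannian n H k (H (n - k - 1) (k + 1))) \<and>
           embedded_dim n H Q k (A_grassmannian n H k (H (n - k - 1) (k + 1)))
             = f k * f (k + 1)) \<and>
        naturally_embedded n H Q m (H m (m + 1)) (C_grassmannian n H Q m) \<and>
        real (embedded_dim n H Q m (C_grassmannian n H Q m))
          = real (f m) * (real (f m) + 1) / 2)
   \<and> (n = 2 * m \<and> DIM('v) = 2 * l \<longrightarrow>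
        real (endo.dim (isometry_component n H Q (-1) 1)) =
          (\<Sum>k=0..m-2. real (f k) * real (f (k + 1)))
          + real (f (m - 1)) * real (f m) / 2
          + real (f (m - 1)) * real (f m) / 2 \<and>
        (\<forall>k\<in>{0..m-2}.
           naturally_embedded n H Q k (H (n - k - 1) (k + 1))
             (A_grassmannian n H k (H (n - k - 1) (k + 1))) \<and>
           embedded_dim n H Q k (A_grassmannian n H k (H (n - k - 1) (k + 1)))
             = f k * f (k + 1)) \<and>
        (\<forall>V1 V2. isotropic_splitting Q (H m m) V1 V2 {0} \<longrightarrow>
           (\<forall>B\<in>{V1, V2}.
              naturally_embedded n H Q (m - 1) B (A_grassmannian n H (m - 1) B) \<and>
              real (embedded_dim n H Q (m - 1) (A_grassmannian n H (m - 1) B))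
                = real (f (m - 1)) * real (f m) / 2)))"
proof -
  interpret polarised_hodge_structure n H Q using assms(1,2) by unfold_locales
  have half: "real a = (real b * real c - real b * real e) / 2"
    if "2 * a + b * e = b * c" for a b c e :: nat
    using arg_cong[OF that, of real] by simp
  have even: "real (endo.dim (isometry_component n H Q (-1) 1))
      = (\<Sum>k=0..m-2. real (f k) * real (f (k + 1))) + real (f (m - 1)) * real (f m)"
    if "n = 2 * m"
    by (simp add: dim_lower_component_even_split[OF that] assms(3))
  have block: "naturally_embedded n H Q k (H (n - k - 1) (k + 1))
         (A_grassmannian n H k (H (n - k - 1) (k + 1))) \<and>
       embedded_dim n H Q k (A_grassmannian n H k (H (n - k - 1) (k + 1))) = f k * f (k + 1)"
    if "2 * k + 2 < n" for k
    using full_block_embedded[OF that] assms(3) by simp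
  have even_blocks: "n = 2 * m \<Longrightarrow> \<forall>k\<in>{0..m-2}. naturally_embedded n H Q k (H (n - k - 1) (k + 1))
         (A_grassmannian n H k (H (n - k - 1) (k + 1))) \<and>
       embedded_dim n H Q k (A_grassmannian n H k (H (n - k - 1) (k + 1))) = f k * f (k + 1)"
    by (rule ballI, rule block) simp
  have odd_blocks: "n = 2 * m + 1 \<Longrightarrow> \<forall>k\<in>{0..m-1}. naturally_embedded n H Q k (H (n - k - 1) (k + 1))
         (A_grassmannian n H k (H (n - k - 1) (k + 1))) \<and>
       embedded_dim n H Q k (A_grassmannian n H k (H (n - k - 1) (k + 1))) = f k * f (k + 1)"
    by (rule ballI, rule block) simp
  have halves: "naturally_embedded n H Q (m - 1) B (A_grassmannian n H (m - 1) B) \<and>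
      real (embedded_dim n H Q (m - 1) (A_grassmannian n H (m - 1) B))
        = real (f (m - 1)) * (real (f m) - real (cx.dim L)) / 2"
    if "n = 2 * m" "isotropic_splitting Q (H m m) V1 V2 L" "B \<in> {V1, V2}" for V1 V2 L B
    using isotropic_half_embedded(1)[OF that] half[OF isotropic_half_embedded(2)[OF that]]
    by (simp add: assms(3) algebra_simps)
  have odd: "real (endo.dim (isometry_component n H Q (-1) 1)) =
      (\<Sum>k=0..m-1. real (f k) * real (f (k + 1))) + real (f m) * (real (f m) + 1) / 2"
    if "n = 2 * m + 1"
    using arg_cong[OF dim_lower_component_odd[OF that], of real] by (simp add: assms(3) field_simps)
  have lagr: "naturally_embedded n H Q m (H m (m + 1)) (C_grassmannian n H Q m) \<and>
      real (embedded_dim n H Q m (C_grassmannian n H Q m)) = real (f m) * (real (f m) + 1) / 2"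
    if "n = 2 * m + 1"
    using C_grassmannian_embedded(1)[OF that] arg_cong[OF C_grassmannian_embedded(2)[OF that], of real]
    by (simp add: assms(3) field_simps)
  have B_case: "n = 2 * m \<Longrightarrow> isotropic_splitting Q (H m m) V1 V2 L \<and> cx.dim L = 1 \<Longrightarrow> B \<in> {V1, V2} \<Longrightarrow>
      naturally_embedded n H Q (m - 1) B (A_grassmannian n H (m - 1) B) \<and>
      real (embedded_dim n H Q (m - 1) (A_grassmannian n H (m - 1) B))
        = real (f (m - 1)) * (real (f m) - 1) / 2" for V1 V2 L B
    using halves[of V1 V2 L B] by simp
  have D_case: "n = 2 * m \<Longrightarrow> isotropic_splitting Q (H m m) V1 V2 {0} \<Longrightarrow> B \<in> {V1, V2} \<Longrightarrow>
      naturally_embedded n H Q (m - 1) B (A_grassmannian n H (m - 1) B) \<and>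
      real (embedded_dim n H Q (m - 1) (A_grassmannian n H (m - 1) B))
        = real (f (m - 1)) * real (f m) / 2" for V1 V2 B
    using halves[of V1 V2 "{0}" B] by simp
  show ?thesis
  proof (intro conjI impI)
    assume n: "n = 2 * m \<and> DIM('v) = 2 * l + 1"
    show "real (endo.dim (isometry_component n H Q (-1) 1)) =
          (\<Sum>k=0..m-2. real (f k) * real (f (k + 1)))
          + real (f (m - 1)) * (real (f m) - 1) / 2
          + real (f (m - 1)) * (real (f m) - 1) / 2
          + real (f (m - 1))"
      using even n by (simp add: field_simps)
  next
    assume n: "n = 2 * m \<and> DIM('v) = 2 * l"
    show "real (endo.dim (isometry_component n H Q (-1) 1)) =
          (\<Sum>k=0..m-2. real (f k) * real (f (k + 1)))
          + real (f (m - 1)) * real (f m) / 2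
          + real (f (m - 1)) * real (f m) / 2"
      using even n by simp
  qed (use even_blocks odd_blocks odd lagr B_case D_case in blast)+
qed

end
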